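(* For every P$''$-graph $D$ there is a construction whose root graph is $D$; that is, every P$''$-graph is a P$'$-graph.
   Context: A graph is a pair of functions $W,E\colon A\to V$ with $A\cap V=\emptyset$. Let $X$ range over $\{W,E\}$, $\bar W=E$, $\bar E=W$. A vertex $v$ is an $X$-vertex if there is no edge $a$ with $\bar X(a)=v$; $X(D)$ is the set of $X$-vertices; inner vertices are those that are neither. An edge $a$ is an $X$-edge if $X(a)$ is an $X$-vertex. $W$-$E$-functional: for every $X$-edge $a$ and edge $b\ne a$, $X(a)\ne X(b)$. A semipath from $v_0$ to $v_n$ is $v_0a_1v_1\dots a_nv_n$ ($n\ge0$) with $\{W(a_i),E(a_i)\}=\{v_{i-1},v_i\}$ and no repeated vertex; weakly connected means any two distinct vertices are joined by a semipath; a cycle is a directed closed walk $v_0a_1\dots a_nv_n$, $n\ge1$, $W(a_i)=v_{i-1}$, $E(a_i)=v_i$, vertices distinct except $v_0=v_n$. A D-graph is a finite, acyclic, $W$-$E$-functional, weakly connected graph with an inner vertex; basic if exactly one inner vertex. Juncture: for D-graphs $D_W=(W_W,E_W\colon A_W\to V_W)$, $D_E=(W_E,E_E\colon A_E\to V_E)$, $D_W\Box D_E$ is defined when $C=A_W\cap A_E\ne\emptyset$, $E_W(a)=W_E(a)$ for $a\in C$, each $a\in C$ is an $E$-edge of $D_W$ and a $W$-edge of $D_E$, and $V_W\cap V_E=V_C:=\{E_W(a)\mid a\in C\}$; it has edges $A_W\cup A_E$, vertices $(V_W\cup V_E)\setminus V_C$, $W(a)=W_W(a)$ if $a\in A_W$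 else $W_E(a)$, $E(a)=E_E(a)$ if $a\in A_E$ else $E_W(a)$. A list is a finite sequence of distinct elements. Nonempty lists are compatible if they are $\Phi_1\Xi\Psi_1$ and $\Phi_2\Xi\Psi_2$ with $\Xi$ nonempty, $\Phi_1,\Phi_2,\Psi_1,\Psi_2,\Xi$ pairwise disjoint, at least one of $\Phi_1,\Phi_2$ empty and at least one of $\Psi_1,\Psi_2$ empty. $\Gamma\colon x-y-z$ means $x,y,z$ are distinct members of $\Gamma$ occurring in this order or its reverse. For vertices $u,v$ of a D-graph $D$, $[u,v]$ is the set of semipaths from $u$ to $v$ and $[u]_X=\bigcup_{v\in X(D)}[u,v]$; semipaths intersect if they share a vertex. For distinct $X$-vertices $u,v,w$, $\psi_X(v,u,w)$ means every semipath in $[v,w]$ intersects every semipath in $[u]_{\bar X}$. A list $\Lambda$ of $X(D)$ is grounded in $D$ if $\Lambda\colon v-u-w$ implies $\psi_X(v,u,w)$. D-graphs $D_W,D_E$ with $D_W\Box D_E$ defined are P-compatible if some list of $E(D_W)$ grounded in $D_W$ and some list of $W(D_E)$ grounded in $D_E$ are compatible. P$''$-graphs are defined inductively: basic D-graphs are P$''$-graphs; if $D_W,D_E$ are P-compatible P$''$-graphs then $D_W\Box D_E$ is a P$''$-graph. Constructions: finite binary trees with a triple $(D,L_W,L_E)$ in each node, $D$ a D-graph, $L_X$ a list of all of $X(D)$. A single node with a basic D-graph and arbitrary such lists is a construction; if $K_W,K_E$ are constructions with roots $(D_W,L^W_W,L^W_E)$ and $(D_E,L^E_W,L^E_E)$,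 $D_W\Box D_E$ is defined and $L^W_E=\Phi_E\Xi\Psi_E$, $L^E_W=\Phi_W\Xi\Psi_W$ are compatible, then a new root with successors the roots of $K_W,K_E$ containing $(D_W\Box D_E,\Phi_WL^W_W\Psi_W,\Phi_EL^E_E\Psi_E)$ gives a construction. The root graph of a construction is the D-graph in its root; a P$'$-graph is the root graph of some construction. *)

theory Defs
  imports "Graph_Theory.Graph_Theory"
begin

text \<open>
  A graph given by two functions from edges to vertices is a well-formed \<^typ>\<open>('v, 'e) pre_digraph\<close>:
  the first function is \<^const>\<open>tail\<close>, the second is \<^const>\<open>head\<close>. Edges and vertices being
  disjoint is expressed by their having different types. The values of \<^const>\<open>tail\<close> and
  \<^const>\<open>head\<close> outside \<^const>\<open>arcs\<close> have no meaning.
\<close>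

datatype side = W | E

fun opp :: "side \<Rightarrow> side" where
  "opp W = E"
| "opp E = W"

fun endpt :: "side \<Rightarrow> ('v, 'e) pre_digraph \<Rightarrow> 'e \<Rightarrow> 'v" where
  "endpt W D = tail D"
| "endpt E D = head D"

definition X_verts :: "side \<Rightarrow> ('v, 'e) pre_digraph \<Rightarrow> 'v set" where
  "X_verts X D = {v \<in> verts D. \<not> (\<exists>a \<in> arcs D. endpt (opp X) D a = v)}"

definition inner_verts :: "('v, 'e) pre_digraph \<Rightarrow> 'v set" where
  "inner_verts D = verts D - X_verts W D - X_verts E D"

definition X_arcs :: "side \<Rightarrow> ('v, 'e) pre_digraph \<Rightarrow> 'e set" where
  "X_arcs X D = {a \<in> arcs D. endpt X D a \<in> X_verts X D}"

definition WE_functional :: "('v, 'e) pre_digraph \<Rightarrow> bool" where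
  "WE_functional D \<longleftrightarrow>
     (\<forall>X. \<forall>a \<in> X_arcs X D. \<forall>b \<in> arcs D. b \<noteq> a \<longrightarrow> endpt X D a \<noteq> endpt X D b)"

text \<open>
  The semipath $v_0 a_1 v_1 \dots a_n v_n$ is the pair of the lists
  $v_0, \dots, v_n$ and $a_1, \dots, a_n$.
\<close>

type_synonym ('v, 'e) semipath = "'v list \<times> 'e list"

definition semipath :: "('v, 'e) pre_digraph \<Rightarrow> ('v, 'e) semipath \<Rightarrow> bool" where
  "semipath D = (\<lambda>(vs, as).
     length vs = Suc (length as) \<and> distinct vs \<and>
     set vs \<subseteq> verts D \<and> set as \<subseteq> arcs D \<and>
     (\<forall>i < length as. {tail D (as ! i), head D (as ! i)} = {vs ! i, vs ! Suc i}))"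

definition semipaths :: "('v, 'e) pre_digraph \<Rightarrow> 'v \<Rightarrow> 'v \<Rightarrow> ('v, 'e) semipath set" where
  "semipaths D u v = {p. semipath D p \<and> hd (fst p) = u \<and> last (fst p) = v}"

definition semipaths_to :: "side \<Rightarrow> ('v, 'e) pre_digraph \<Rightarrow> 'v \<Rightarrow> ('v, 'e) semipath set" where
  "semipaths_to X D u = (\<Union>v \<in> X_verts X D. semipaths D u v)"

definition intersect :: "('v, 'e) semipath \<Rightarrow> ('v, 'e) semipath \<Rightarrow> bool" where
  "intersect p q \<longleftrightarrow> set (fst p) \<inter> set (fst q) \<noteq> {}"

definition weakly_connected :: "('v, 'e) pre_digraph \<Rightarrow> bool" where
  "weakly_connected D \<longleftrightarrow>
     (\<forall>u \<in> verts D. \<forall>v \<in> verts D. u \<noteq> v \<longrightarrow> semipaths D u v \<noteq> {})"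

definition D_graph :: "('v, 'e) pre_digraph \<Rightarrow> bool" where
  "D_graph D \<longleftrightarrow>
     fin_digraph D \<and> (\<nexists>p. pre_digraph.cycle D p) \<and> WE_functional D \<and>
     weakly_connected D \<and> inner_verts D \<noteq> {}"

definition basic_D_graph :: "('v, 'e) pre_digraph \<Rightarrow> bool" where
  "basic_D_graph D \<longleftrightarrow> D_graph D \<and> (\<exists>!v. v \<in> inner_verts D)"

definition cut_arcs :: "('v, 'e) pre_digraph \<Rightarrow> ('v, 'e) pre_digraph \<Rightarrow> 'e set" where
  "cut_arcs DW DE = arcs DW \<inter> arcs DE"

definition cut_verts :: "('v, 'e) pre_digraph \<Rightarrow> ('v, 'e) pre_digraph \<Rightarrow> 'v set" where
  "cut_verts DW DE = head DW ` cut_arcs DW DE"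

definition juncture_defined :: "('v, 'e) pre_digraph \<Rightarrow> ('v, 'e) pre_digraph \<Rightarrow> bool" where
  "juncture_defined DW DE \<longleftrightarrow>
     D_graph DW \<and> D_graph DE \<and>
     cut_arcs DW DE \<noteq> {} \<and>
     (\<forall>a \<in> cut_arcs DW DE.
        head DW a = tail DE a \<and> a \<in> X_arcs E DW \<and> a \<in> X_arcs W DE) \<and>
     verts DW \<inter> verts DE = cut_verts DW DE"

definition juncture ::
    "('v, 'e) pre_digraph \<Rightarrow> ('v, 'e) pre_digraph \<Rightarrow> ('v, 'e) pre_digraph" where
  "juncture DW DE =
     \<lparr> verts = (verts DW \<union> verts DE) - cut_verts DW DE,
       arcs = arcs DW \<union> arcs DE,
       tail = (\<lambda>a. if a \<in> arcs DW then tail DW a else tail DE a),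
       head = (\<lambda>a. if a \<in> arcs DE then head DE a else head DW a) \<rparr>"

text \<open>
  Distinctness of the concatenation says at once that each of the five parts is free of
  repetitions and that they are pairwise disjoint.
\<close>

definition compatible_parts ::
    "'v list \<Rightarrow> 'v list \<Rightarrow> 'v list \<Rightarrow> 'v list \<Rightarrow> 'v list \<Rightarrow> bool" where
  "compatible_parts \<Phi>1 \<Phi>2 \<Xi> \<Psi>1 \<Psi>2 \<longleftrightarrow>
     \<Xi> \<noteq> [] \<and> distinct (\<Phi>1 @ \<Phi>2 @ \<Xi> @ \<Psi>1 @ \<Psi>2) \<and>
     (\<Phi>1 = [] \<or> \<Phi>2 = []) \<and> (\<Psi>1 = [] \<or> \<Psi>2 = [])"

definition compatible :: "'v list \<Rightarrow> 'v list \<Rightarrow> bool" where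
  "compatible \<Gamma> \<Delta> \<longleftrightarrow>
     (\<exists>\<Phi>1 \<Phi>2 \<Xi> \<Psi>1 \<Psi>2. \<Gamma> = \<Phi>1 @ \<Xi> @ \<Psi>1 \<and> \<Delta> = \<Phi>2 @ \<Xi> @ \<Psi>2 \<and>
        compatible_parts \<Phi>1 \<Phi>2 \<Xi> \<Psi>1 \<Psi>2)"

definition list_of :: "'v list \<Rightarrow> 'v set \<Rightarrow> bool" where
  "list_of \<Lambda> S \<longleftrightarrow> distinct \<Lambda> \<and> set \<Lambda> = S"

definition between :: "'v list \<Rightarrow> 'v \<Rightarrow> 'v \<Rightarrow> 'v \<Rightarrow> bool" where
  "between \<Gamma> x y z \<longleftrightarrow>
     distinct [x, y, z] \<and>
     (\<exists>i j k. i < length \<Gamma> \<and> j < length \<Gamma> \<and> k < length \<Gamma> \<and>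
        \<Gamma> ! i = x \<and> \<Gamma> ! j = y \<and> \<Gamma> ! k = z \<and> (i < j \<and> j < k \<or> k < j \<and> j < i))"

text \<open>Only meaningful, and only used below, for distinct $X$-vertices $v, u, w$.\<close>

definition psi :: "side \<Rightarrow> ('v, 'e) pre_digraph \<Rightarrow> 'v \<Rightarrow> 'v \<Rightarrow> 'v \<Rightarrow> bool" where
  "psi X D v u w \<longleftrightarrow>
     (\<forall>p \<in> semipaths D v w. \<forall>q \<in> semipaths_to (opp X) D u. intersect p q)"

definition grounded :: "side \<Rightarrow> ('v, 'e) pre_digraph \<Rightarrow> 'v list \<Rightarrow> bool" where
  "grounded X D \<Lambda> \<longleftrightarrow>
     list_of \<Lambda> (X_verts X D) \<and> (\<forall>v u w. between \<Lambda> v u w \<longrightarrow> psi X D v u w)"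

definition P_compatible :: "('v, 'e) pre_digraph \<Rightarrow> ('v, 'e) pre_digraph \<Rightarrow> bool" where
  "P_compatible DW DE \<longleftrightarrow>
     juncture_defined DW DE \<and>
     (\<exists>\<Gamma> \<Delta>. grounded E DW \<Gamma> \<and> grounded W DE \<Delta> \<and> compatible \<Gamma> \<Delta>)"

inductive P''_graph :: "('v, 'e) pre_digraph \<Rightarrow> bool" where
  basic: "basic_D_graph D \<Longrightarrow> P''_graph D"
| junct: "\<lbrakk>P''_graph DW; P''_graph DE; P_compatible DW DE\<rbrakk> \<Longrightarrow> P''_graph (juncture DW DE)"

type_synonym ('v, 'e) label = "('v, 'e) pre_digraph \<times> 'v list \<times> 'v list"

datatype 'l btree = Single 'l | Branch 'l "'l btree" "'l btree"

fun root_label :: "'l btree \<Rightarrow> 'l" where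
  "root_label (Single l) = l"
| "root_label (Branch l K1 K2) = l"

definition valid_label :: "('v, 'e) label \<Rightarrow> bool" where
  "valid_label = (\<lambda>(D, LW, LE).
     D_graph D \<and> list_of LW (X_verts W D) \<and> list_of LE (X_verts E D))"

inductive construction :: "('v, 'e) label btree \<Rightarrow> bool" where
  single: "\<lbrakk>basic_D_graph D; valid_label (D, LW, LE)\<rbrakk> \<Longrightarrow> construction (Single (D, LW, LE))"
| branch: "\<lbrakk>construction KW; root_label KW = (DW, LWW, \<Phi>E @ \<Xi> @ \<Psi>E);
            construction KE; root_label KE = (DE, \<Phi>W @ \<Xi> @ \<Psi>W, LEE);
            juncture_defined DW DE;
            compatible_parts \<Phi>E \<Phi>W \<Xi> \<Psi>E \<Psi>W;
            l = (juncture DW DE, \<Phi>W @ LWW @ \<Psi>W, \<Phi>E @ LEE @ \<Psi>E);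
            valid_label l\<rbrakk>
           \<Longrightarrow> construction (Branch l KW KE)"

definition root_graph :: "('v, 'e) label btree \<Rightarrow> ('v, 'e) pre_digraph" where
  "root_graph K = fst (root_label K)"

definition P'_graph :: "('v, 'e) pre_digraph \<Rightarrow> bool" where
  "P'_graph D \<longleftrightarrow> (\<exists>K. construction K \<and> root_graph K = D)"

end

theory Submission
  imports Defs "HOL-Library.Sublist"
begin

text \<open>
  A split is a partition of the vertices into two connected sets. If a list of $X(D)$ is grounded,
  then for $v, u, w$ in this order no split has $v, w$ on one side and $u$ together with an
  $\bar X$-vertex on the other. Along the inductive definition of a P$''$-graph a family of splits
  is glued together, starting from the empty family for basic graphs. Lists of $W(D)$ and of $E(D)$
  are planar for the family if no split crosses itself on the cyclic word formed by the first list
  and the reverse of the second.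

  By induction on the P$''$-graph: planar lists are the lists in the root of a construction; any two
  lists shielded by the family are planar after possibly reversing one of them; planar lists exist.
  In the induction step, noncrossing cyclic words $u\,\Xi^{-1}$ and $\Xi\,v$ of the two parts
  give the noncrossing word $u\,v$ of the juncture. Conversely, shielded lists of the juncture
  restrict to the parts, and the list $\Xi$ of the cut provided by P-compatibility, or its reverse,
  completes the restrictions to planar lists of the parts.
\<close>

section \<open>Subsequences of concatenations\<close>

text \<open>A construction carries a list of \<open>W(D)\<close> together with a list of
  \<open>E(D)\<close>, whereas P-compatibility promises a grounded list of one side only, and the
  lists promised at a later juncture need not be those at the root of a construction built before.
  Hence the induction must provide constructions for every pair of lists that can be asked for, and
  must know which pairs these are. The criterion imitates a drawing in a disc with
  \<open>W(D)\<close> and \<open>E(D)\<close> along the boundary: two disjoint connected sets cannot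
  alternate there. Grounding controls alternations with three letters in one list, but not those
  with two letters in each; it leaves open how the two lists are oriented against each other.
  Settling this reversal for both parts with a common list of the cut is the main difficulty. It is
  most delicate where one part accepts both orientations, because then the one required by the other
  part has to be chosen.\<close>

lemma ex_append_eq_Cons:
  "(\<exists>xs1 xs2. x # xs = xs1 @ xs2 \<and> R xs1 xs2) \<longleftrightarrow>
     R [] (x # xs) \<or> (\<exists>xs1 xs2. xs = xs1 @ xs2 \<and> R (x # xs1) xs2)"
  by (auto simp: Cons_eq_append_conv)

lemma subseq_2_append:
  "subseq [x, y] (u @ v) \<longleftrightarrow> subseq [x, y] u \<or> x \<in> set u \<and> y \<in> set v \<or> subseq [x, y] v"
  unfolding subseq_append_iff ex_append_eq_Cons by (auto simp: subseq_singleton_left)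

lemma subseq_3_append:
  "subseq [x, y, z] (u @ v) \<longleftrightarrow>
     subseq [x, y, z] u \<or> subseq [x, y] u \<and> z \<in> set v \<or>
     x \<in> set u \<and> subseq [y, z] v \<or> subseq [x, y, z] v"
  unfolding subseq_append_iff ex_append_eq_Cons by (auto simp: subseq_singleton_left)

lemma subseq_4_append:
  "subseq [a, b, c, d] (u @ v) \<longleftrightarrow>
     subseq [a, b, c, d] u \<or> subseq [a, b, c] u \<and> d \<in> set v \<or>
     subseq [a, b] u \<and> subseq [c, d] v \<or> a \<in> set u \<and> subseq [b, c, d] v \<or>
     subseq [a, b, c, d] v"
  unfolding subseq_append_iff ex_append_eq_Cons by (auto simp: subseq_singleton_left)

lemma subseq_imp_set: "subseq xs ys \<Longrightarrow> set xs \<subseteq> set ys"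
  by (auto dest: list_emb_set)

lemma subseq_2_in_set:
  assumes "subseq [x, y] l" shows "x \<in> set l" "y \<in> set l"
  using subseq_imp_set[OF assms] by auto

lemma subseq_3_in_set:
  assumes "subseq [x, y, z] l" shows "x \<in> set l" "y \<in> set l" "z \<in> set l"
  using subseq_imp_set[OF assms] by auto

lemma subseq_4_in_set:
  assumes "subseq [x, y, z, t] l" shows "x \<in> set l" "y \<in> set l" "z \<in> set l" "t \<in> set l"
  using subseq_imp_set[OF assms] by auto

lemma subseq_4_appendE:
  assumes "subseq [a, b, c, d] (u @ v)"
  obtains "subseq [a, b, c, d] u" "a \<in> set u" "b \<in> set u" "c \<in> set u" "d \<in> set u"
  | "subseq [a, b, c] u" "a \<in> set u" "b \<in> set u" "c \<in> set u" "d \<in> set v"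
  | "subseq [a, b] u" "subseq [c, d] v" "a \<in> set u" "b \<in> set u" "c \<in> set v" "d \<in> set v"
  | "subseq [b, c, d] v" "a \<in> set u" "b \<in> set v" "c \<in> set v" "d \<in> set v"
  | "subseq [a, b, c, d] v" "a \<in> set v" "b \<in> set v" "c \<in> set v" "d \<in> set v"
  using assms unfolding subseq_4_append
  by (elim disjE conjE) (meson subseq_2_in_set subseq_3_in_set subseq_4_in_set)+

lemma subseq_rev_iff: "subseq (rev xs) (rev ys) \<longleftrightarrow> subseq xs ys"
proof -
  have *: "subseq (rev xs) (rev ys)" if "subseq xs ys" for xs ys :: "'a list"
    using that by (induction rule: list_emb.induct) (auto intro: list_emb_append_mono subseq_rev_drop_many)
  show ?thesis using *[of xs ys] *[of "rev xs" "rev ys"] by auto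
qed

lemma subseq_2_rev: "subseq [x, y] (rev l) \<longleftrightarrow> subseq [y, x] l"
  using subseq_rev_iff[of "[y, x]" l] by simp

lemma subseq_3_rev: "subseq [x, y, z] (rev l) \<longleftrightarrow> subseq [z, y, x] l"
  using subseq_rev_iff[of "[z, y, x]" l] by simp

lemma subseq_2_total:
  assumes "x \<in> set l" "y \<in> set l" "x \<noteq> y"
  shows "subseq [x, y] l \<or> subseq [y, x] l"
  using assms by (induction l) (auto simp: subseq_singleton_left)

lemma subseq_2_trans:
  assumes "distinct l" "subseq [x, y] l" "subseq [y, z] l"
  shows "subseq [x, y, z] l"
  using assms
proof (induction l)
  case (Cons a l)
  show ?case
  proof (cases "y = a")
    case True
    then show ?thesis using Cons.prems
      by (metis distinct.simps(2) list.set_intros(1) list_emb_Cons_iff1 subseq_2_in_set(2)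
          subseq_Cons2_iff subseq_Cons' subseq_singleton_left set_ConsD subseq_Cons2_neq)
  next
    case False
    then have "subseq [y, z] l" using Cons.prems by simp
    then show ?thesis using Cons by (auto split: if_splits)
  qed
qed simp

text \<open>Scanning from the right, the block of letters of \<open>S\<close> grows only at its left
  end: once a letter outside \<open>S\<close> stands in front of the block, a further letter of
  \<open>S\<close> would enclose it.\<close>

lemma contiguous_decomposition:
  assumes "\<And>x y z. subseq [x, y, z] l \<Longrightarrow> x \<in> S \<Longrightarrow> z \<in> S \<Longrightarrow> y \<in> S"
  obtains a b c where "l = a @ b @ c" "set b \<subseteq> S" "set a \<inter> S = {}" "set c \<inter> S = {}"
proof -
  have "\<exists>a b c. l = a @ b @ c \<and> set b \<subseteq> S \<and> set a \<inter> S = {} \<and> set c \<inter> S = {}"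
    using assms
  proof (induction l)
    case (Cons h t)
    have "\<And>x y z. subseq [x, y, z] t \<Longrightarrow> x \<in> S \<Longrightarrow> z \<in> S \<Longrightarrow> y \<in> S"
      using Cons.prems by (meson list_emb_Cons)
    then obtain a b c where abc: "t = a @ b @ c" "set b \<subseteq> S" "set a \<inter> S = {}" "set c \<inter> S = {}"
      using Cons.IH by blast
    consider "h \<notin> S" | "h \<in> S" "b = []" | "h \<in> S" "b \<noteq> []" by blast
    then show ?case
    proof cases
      case 1
      then have "h # t = (h # a) @ b @ c \<and> set b \<subseteq> S \<and> set (h # a) \<inter> S = {} \<and> set c \<inter> S = {}"
        using abc by auto
      then show ?thesis by blast
    next
      case 2
      \<comment> \<open>The tail contains no letter of \<open>S\<close>, so all of it goes to the
        right of the new block.\<close>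
      then have "h # t = [] @ [h] @ (a @ c) \<and> set [h] \<subseteq> S \<and> set [] \<inter> S = {} \<and> set (a @ c) \<inter> S = {}"
        using abc by auto
      then show ?thesis by blast
    next
      case 3
      then obtain s where s: "s \<in> set b" by (cases b) auto
      have "a = []"
      proof (rule ccontr)
        assume "a \<noteq> []"
        then obtain k where k: "k \<in> set a" by (cases a) auto
        have "subseq [h, k, s] (h # t)"
          using k s by (simp add: abc subseq_2_append subseq_singleton_left)
        then show False using Cons.prems 3 s k abc by blast
      qed
      then have "h # t = [] @ (h # b) @ c \<and> set (h # b) \<subseteq> S \<and> set [] \<inter> S = {} \<and> set c \<inter> S = {}"
        using abc 3 by auto
      then show ?thesis by blast
    qed
  qed simp
  then show ?thesis using that by blast
qed

section \<open>Splits and noncrossing lists\<close>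

text \<open>The counterpart of $\psi_X(x,y,z)$, with \<open>T\<close> as the set of $\bar X$-vertices.\<close>

definition shielded :: "('v set \<Rightarrow> 'v set \<Rightarrow> bool) \<Rightarrow> 'v set \<Rightarrow> 'v \<Rightarrow> 'v \<Rightarrow> 'v \<Rightarrow> bool" where
  "shielded sp T x y z \<longleftrightarrow>
     (\<forall>P Q. sp P Q \<longrightarrow> x \<in> P \<longrightarrow> z \<in> P \<longrightarrow> y \<in> Q \<longrightarrow> Q \<inter> T = {})"

definition shielded_list :: "('v set \<Rightarrow> 'v set \<Rightarrow> bool) \<Rightarrow> 'v set \<Rightarrow> 'v list \<Rightarrow> bool" where
  "shielded_list sp T l \<longleftrightarrow> (\<forall>x y z. subseq [x, y, z] l \<longrightarrow> shielded sp T x y z)"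

text \<open>Along \<open>LA @ rev LB\<close> the letters come in the order \<open>x\<close>,
  \<open>y\<close>, \<open>e\<close>, \<open>f\<close>: an alternation with two letters in each
  list, the kind that shielding does not see.\<close>

definition uncrossed :: "('v set \<Rightarrow> 'v set \<Rightarrow> bool) \<Rightarrow> 'v list \<Rightarrow> 'v list \<Rightarrow> bool" where
  "uncrossed sp LA LB \<longleftrightarrow>
     (\<forall>P Q x y e f. sp P Q \<longrightarrow> x \<in> P \<longrightarrow> e \<in> P \<longrightarrow> y \<in> Q \<longrightarrow> f \<in> Q \<longrightarrow>
        subseq [x, y] LA \<longrightarrow> \<not> subseq [f, e] LB)"

definition planar :: "('v set \<Rightarrow> 'v set \<Rightarrow> bool) \<Rightarrow> 'v list \<Rightarrow> 'v list \<Rightarrow> bool" where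
  "planar sp LA LB \<longleftrightarrow>
     shielded_list sp (set LB) LA \<and> shielded_list sp (set LA) LB \<and> uncrossed sp LA LB"

definition noncrossing :: "'v list \<Rightarrow> 'v set \<Rightarrow> 'v set \<Rightarrow> bool" where
  "noncrossing w P Q \<longleftrightarrow>
     (\<forall>a b c d. subseq [a, b, c, d] w \<longrightarrow>
        \<not> (a \<in> P \<and> b \<in> Q \<and> c \<in> P \<and> d \<in> Q) \<and> \<not> (a \<in> Q \<and> b \<in> P \<and> c \<in> Q \<and> d \<in> P))"

text \<open>Both sides have to reach \<open>T\<close> so that elements of \<open>T\<close> can later
  stand in for \<open>x\<close> and \<open>y\<close> in a list of \<open>T\<close>.\<close>

definition separated :: "('v set \<Rightarrow> 'v set \<Rightarrow> bool) \<Rightarrow> 'v set \<Rightarrow> 'v \<Rightarrow> 'v \<Rightarrow> bool" where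
  "separated sp T x y \<longleftrightarrow>
     (\<exists>P Q. sp P Q \<and> x \<in> P \<and> y \<in> Q \<and> P \<inter> T \<noteq> {} \<and> Q \<inter> T \<noteq> {})"

text \<open>No split divides \<open>A\<close> and \<open>B\<close> at once. This is the ambiguous
  case: planarity then survives the reversal of one list alone.\<close>

definition unlinked :: "('v set \<Rightarrow> 'v set \<Rightarrow> bool) \<Rightarrow> 'v set \<Rightarrow> 'v set \<Rightarrow> bool" where
  "unlinked sp A B \<longleftrightarrow>
     (\<forall>P Q. sp P Q \<longrightarrow> P \<inter> A = {} \<or> Q \<inter> A = {} \<or> P \<inter> B = {} \<or> Q \<inter> B = {})"

lemma shieldedD:
  "shielded sp T x y z \<Longrightarrow> sp P Q \<Longrightarrow> x \<in> P \<Longrightarrow> z \<in> P \<Longrightarrow> y \<in> Q \<Longrightarrow> t \<in> Q \<Longrightarrow> t \<in> T \<Longrightarrow> False"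
  unfolding shielded_def by blast

lemma shieldedI:
  "(\<And>P Q t. sp P Q \<Longrightarrow> x \<in> P \<Longrightarrow> z \<in> P \<Longrightarrow> y \<in> Q \<Longrightarrow> t \<in> Q \<Longrightarrow> t \<in> T \<Longrightarrow> False) \<Longrightarrow> shielded sp T x y z"
  unfolding shielded_def by blast

lemma shielded_commute: "shielded sp T x y z \<longleftrightarrow> shielded sp T z y x"
  unfolding shielded_def by blast

lemma shielded_listD: "shielded_list sp T l \<Longrightarrow> subseq [x, y, z] l \<Longrightarrow> shielded sp T x y z"
  unfolding shielded_list_def by blast

lemma shielded_list_rev: "shielded_list sp T (rev l) \<longleftrightarrow> shielded_list sp T l"
  unfolding shielded_list_def subseq_3_rev using shielded_commute by metis

lemma shielded_list_subseq: "shielded_list sp T l \<Longrightarrow> subseq l' l \<Longrightarrow> shielded_list sp T l'"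
  unfolding shielded_list_def using subseq_order.order_trans by blast

lemma noncrossing_commute: "noncrossing w P Q \<longleftrightarrow> noncrossing w Q P"
  unfolding noncrossing_def by blast

text \<open>An alternation read from another starting point is again one, possibly with
  \<open>P\<close> and \<open>Q\<close> exchanged; for this reason \<open>noncrossing\<close>
  excludes both forms.\<close>

lemma noncrossing_rotate:
  assumes "noncrossing (u @ v) P Q" shows "noncrossing (v @ u) P Q"
  unfolding noncrossing_def
proof (intro allI impI)
  fix a b c d assume "subseq [a, b, c, d] (v @ u)"
  then have "subseq [a, b, c, d] (u @ v) \<or> subseq [b, c, d, a] (u @ v) \<or>
      subseq [c, d, a, b] (u @ v) \<or> subseq [d, a, b, c] (u @ v)"
    by (rule subseq_4_appendE) (simp_all add: subseq_4_append)
  then show "\<not> (a \<in> P \<and> b \<in> Q \<and> c \<in> P \<and> d \<in> Q) \<and> \<not> (a \<in> Q \<and> b \<in> P \<and> c \<in> Q \<and> d \<in> P)"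
    using assms unfolding noncrossing_def by blast
qed

text \<open>Connectedness of the sides is kept apart from these axioms: it serves only to turn
  grounded lists into shielded ones.\<close>

locale split_family =
  fixes V :: "'v set" and sp :: "'v set \<Rightarrow> 'v set \<Rightarrow> bool"
  assumes sp_sym: "sp P Q \<Longrightarrow> sp Q P"
    and sp_cover: "sp P Q \<Longrightarrow> P \<union> Q = V"
    and sp_disjoint: "sp P Q \<Longrightarrow> P \<inter> Q = {}"
begin

lemma separated_commute: "separated sp T x y \<Longrightarrow> separated sp T y x"
  unfolding separated_def using sp_sym by blast

lemma uncrossed_commute: "uncrossed sp LA LB \<longleftrightarrow> uncrossed sp LB LA"
  unfolding uncrossed_def using sp_sym by blast

lemma uncrossed_rev: "uncrossed sp (rev LA) (rev LB) \<longleftrightarrow> uncrossed sp LA LB"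
  unfolding uncrossed_def subseq_2_rev using sp_sym by blast

lemma planar_commute: "planar sp LA LB \<longleftrightarrow> planar sp LB LA"
  unfolding planar_def using uncrossed_commute by blast

lemma planar_rev: "planar sp (rev LA) (rev LB) \<longleftrightarrow> planar sp LA LB"
  unfolding planar_def uncrossed_rev shielded_list_rev by simp

lemma planar_rev_left: "planar sp (rev LA) LB \<longleftrightarrow> planar sp LA (rev LB)"
  using planar_rev[of "LA" "rev LB"] by simp

text \<open>The clauses of \<open>planar\<close> cover the distributions 3+1, 1+3 and 2+2 of an
  alternation over the two lists. Four letters in one list reduce to 3+1: any letter of the other
  list lies in \<open>P\<close> or in \<open>Q\<close> and so violates the shielding of one of the
  two triples. This is where both lists have to be nonempty.\<close>

lemma planar_imp_noncrossing:
  assumes "planar sp LA LB" "set LA \<subseteq> V" "set LB \<subseteq> V" "LA \<noteq> []" "LB \<noteq> []" "sp P Q"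
  shows "noncrossing (LA @ rev LB) P Q"
proof -
  have main: False
    if pq: "sp P Q" and s: "subseq [a, b, c, d] (LA @ rev LB)" and
      m: "a \<in> P" "b \<in> Q" "c \<in> P" "d \<in> Q" for a b c d P Q
  proof -
    have shA: "shielded sp (set LB) x y z" if "subseq [x, y, z] LA" for x y z
      using assms(1) that unfolding planar_def shielded_list_def by blast
    have shB: "shielded sp (set LA) x y z" if "subseq [x, y, z] LB" for x y z
      using assms(1) that unfolding planar_def shielded_list_def by blast
    have unc: "uncrossed sp LA LB" using assms(1) unfolding planar_def by blast
    obtain a0 b0 where ab: "a0 \<in> set LA" "b0 \<in> set LB"
      using assms(4,5) by (meson last_in_set)
    have abV: "a0 \<in> P \<union> Q" "b0 \<in> P \<union> Q" using ab assms(2,3) sp_cover[OF pq] by auto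
    have sq: "sp Q P" using pq sp_sym by blast
    from s[unfolded subseq_4_append]
    consider "subseq [a, b, c, d] LA" | "subseq [a, b, c] LA" "d \<in> set (rev LB)"
      | "subseq [a, b] LA" "subseq [c, d] (rev LB)" | "a \<in> set LA" "subseq [b, c, d] (rev LB)"
      | "subseq [a, b, c, d] (rev LB)" by blast
    then show False
    proof cases
      case 1
      then have "subseq [a, b, c] LA" "subseq [b, c, d] LA"
        using subseq_order.order_trans[of _ "[a, b, c, d]"] by auto
      then show False
        using shieldedD[OF shA pq] shieldedD[OF shA sq] m ab abV by blast
    next
      case 2 then show False using shieldedD[OF shA pq] m by auto
    next
      case 3
      then show False
        using unc pq m unfolding uncrossed_def subseq_2_rev by blast
    next
      case 4 then show False using shieldedD[OF shB sq] m unfolding subseq_3_rev by blast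
    next
      case 5
      then have "subseq [a, b, c] (rev LB)" "subseq [b, c, d] (rev LB)"
        using subseq_order.order_trans[of _ "[a, b, c, d]"] by auto
      then show False unfolding subseq_3_rev
        using shieldedD[OF shB pq] shieldedD[OF shB sq] m ab abV by blast
    qed
  qed
  show ?thesis unfolding noncrossing_def using main assms(6) sp_sym by blast
qed

lemma noncrossing_imp_planar:
  assumes "\<And>P Q. sp P Q \<Longrightarrow> noncrossing (LA @ rev LB) P Q"
  shows "planar sp LA LB"
  unfolding planar_def
proof (intro conjI)
  have nc: False if "sp P Q" "a \<in> P" "b \<in> Q" "c \<in> P" "d \<in> Q"
    "subseq [a, b, c, d] (LA @ rev LB)" for P Q a b c d
    using assms[OF that(1)] that unfolding noncrossing_def by blast
  show "shielded_list sp (set LB) LA"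
    unfolding shielded_list_def
  proof (intro allI impI shieldedI)
    fix x y z P Q t
    assume "subseq [x, y, z] LA" "sp P Q" "x \<in> P" "z \<in> P" "y \<in> Q" "t \<in> Q" "t \<in> set LB"
    then show False using nc[of P Q x y z t] by (simp add: subseq_4_append)
  qed
  show "shielded_list sp (set LA) LB"
    unfolding shielded_list_def
  proof (intro allI impI shieldedI)
    fix x y z P Q t
    assume "subseq [x, y, z] LB" "sp P Q" "x \<in> P" "z \<in> P" "y \<in> Q" "t \<in> Q" "t \<in> set LA"
    then show False using nc[of Q P t z y x] sp_sym by (simp add: subseq_4_append subseq_3_rev)
  qed
  show "uncrossed sp LA LB"
    unfolding uncrossed_def
  proof (intro allI impI notI)
    fix P Q x y e f
    assume "sp P Q" "x \<in> P" "e \<in> P" "y \<in> Q" "f \<in> Q" "subseq [x, y] LA" "subseq [f, e] LB"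
    then show False using nc[of P Q x y e f] by (simp add: subseq_4_append subseq_2_rev)
  qed
qed

lemma unlinked_imp_uncrossed:
  "unlinked sp (set LA) (set LB) \<Longrightarrow> uncrossed sp LA LB"
  unfolding unlinked_def uncrossed_def by (meson disjoint_iff subseq_2_in_set)

lemma planar_both_imp_unlinked:
  assumes "planar sp LA LB" "planar sp (rev LA) LB"
  shows "unlinked sp (set LA) (set LB)"
proof -
  have u: "uncrossed sp LA LB" "uncrossed sp (rev LA) LB" using assms unfolding planar_def by auto
  have False if pq: "sp P Q" and m: "x \<in> P" "y \<in> Q" "e \<in> P" "f \<in> Q"
    and s: "x \<in> set LA" "y \<in> set LA" "e \<in> set LB" "f \<in> set LB" for P Q x y e f
  proof -
    have "x \<noteq> y" "e \<noteq> f" using m sp_disjoint[OF pq] by auto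
    then have "subseq [x, y] LA \<or> subseq [y, x] LA" "subseq [e, f] LB \<or> subseq [f, e] LB"
      using s subseq_2_total by metis+
    then show False
      using u pq sp_sym[OF pq] m unfolding uncrossed_def subseq_2_rev by blast
  qed
  then show ?thesis unfolding unlinked_def by blast
qed

end

section \<open>Gluing families of splits\<close>

text \<open>Not every split of a juncture arises in this way: splits whose sides cross the cut back and
  forth are left out. The inductive argument needs no others.\<close>

inductive glue_sp :: "'v set \<Rightarrow> ('v set \<Rightarrow> 'v set \<Rightarrow> bool) \<Rightarrow> 'v set \<Rightarrow> ('v set \<Rightarrow> 'v set \<Rightarrow> bool) \<Rightarrow>
    'v set \<Rightarrow> 'v set \<Rightarrow> 'v set \<Rightarrow> bool"
  for V1 sp1 V2 sp2 C where
  base: "glue_sp V1 sp1 V2 sp2 C (V1 - C) (V2 - C)"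
| ext1: "sp1 P Q \<Longrightarrow> c \<in> P \<Longrightarrow> c \<in> C \<Longrightarrow> glue_sp V1 sp1 V2 sp2 C ((P - C) \<union> (V2 - C)) (Q - C)"
| ext2: "sp2 P Q \<Longrightarrow> c \<in> P \<Longrightarrow> c \<in> C \<Longrightarrow> glue_sp V1 sp1 V2 sp2 C ((P - C) \<union> (V1 - C)) (Q - C)"
| both: "sp1 P Q \<Longrightarrow> sp2 R T \<Longrightarrow> c \<in> P \<Longrightarrow> c \<in> R \<Longrightarrow> c \<in> C \<Longrightarrow> d \<in> Q \<Longrightarrow> d \<in> T \<Longrightarrow> d \<in> C \<Longrightarrow>
    glue_sp V1 sp1 V2 sp2 C ((P - C) \<union> (R - C)) ((Q - C) \<union> (T - C))"
| sym: "glue_sp V1 sp1 V2 sp2 C P Q \<Longrightarrow> glue_sp V1 sp1 V2 sp2 C Q P"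

lemma glue_sp_swap_imp:
  assumes "glue_sp V1 sp1 V2 sp2 C P Q"
  shows "glue_sp V2 sp2 V1 sp1 C P Q"
  using assms
proof induction
  case base show ?case by (rule glue_sp.sym[OF glue_sp.base])
next
  case (ext1 P Q c) then show ?case by (rule glue_sp.ext2)
next
  case (ext2 P Q c) then show ?case by (rule glue_sp.ext1)
next
  case (both P Q R T c d)
  have "glue_sp V2 sp2 V1 sp1 C ((R - C) \<union> (P - C)) ((T - C) \<union> (Q - C))"
    by (rule glue_sp.both[where c = c and d = d]) (use both in simp_all)
  then show ?case by (simp only: Un_commute)
next
  case (sym P Q) from sym(2) show ?case by (rule glue_sp.sym)
qed

lemma glue_sp_swap: "glue_sp V2 sp2 V1 sp1 C = glue_sp V1 sp1 V2 sp2 C"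
  using glue_sp_swap_imp by (intro ext) blast

section \<open>Two families of splits joined along a cut\<close>

locale board = split_family V sp for V :: "'v set" and sp +
  fixes A B :: "'v set"
  assumes A_subset: "A \<subseteq> V" and B_subset: "B \<subseteq> V"
    and A_nonempty: "A \<noteq> {}" and B_nonempty: "B \<noteq> {}"
    and A_B_disjoint: "A \<inter> B = {}"

text \<open>The branching rule of constructions read backwards: \<open>FA\<close>, \<open>PA\<close>
  are \<Phi> and \<Psi> with index W, \<open>FB\<close>, \<open>PB\<close> those with index E, and
  \<open>X\<close> is \<Xi>. The two \<open>planar\<close> clauses speak of the lists in the two
  successor nodes.\<close>

definition parts :: "'v set \<Rightarrow> ('v set \<Rightarrow> 'v set \<Rightarrow> bool) \<Rightarrow> 'v set \<Rightarrow> ('v set \<Rightarrow> 'v set \<Rightarrow> bool) \<Rightarrow>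
    'v set \<Rightarrow> 'v list \<Rightarrow> 'v list \<Rightarrow> bool" where
  "parts A1 sp1 B2 sp2 C LA LB \<longleftrightarrow>
     (\<exists>FA L1 PA FB L2 PB X. LA = FA @ L1 @ PA \<and> LB = FB @ L2 @ PB \<and>
        (FA = [] \<or> FB = []) \<and> (PA = [] \<or> PB = []) \<and> set X = C \<and> distinct X \<and>
        set L1 = A1 \<and> set L2 = B2 \<and>
        planar sp1 L1 (FB @ X @ PB) \<and> planar sp2 (FA @ X @ PA) L2)"

text \<open>Index 1 stands for the W-part of a juncture and index 2 for its E-part; \<open>A\<close>
  and \<open>B\<close> collect W-vertices and E-vertices.\<close>

locale glued = b1: board V1 sp1 A1 B1 + b2: board V2 sp2 A2 B2
  for V1 :: "'v set" and sp1 A1 B1 V2 sp2 A2 B2 +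
  fixes C :: "'v set"
  assumes C_eq: "C = V1 \<inter> V2" and C_B1: "C \<subseteq> B1" and C_A2: "C \<subseteq> A2" and C_nonempty: "C \<noteq> {}"
begin

abbreviation "V \<equiv> (V1 \<union> V2) - C"
abbreviation "A \<equiv> A1 \<union> (A2 - C)"
abbreviation "B \<equiv> B2 \<union> (B1 - C)"
abbreviation "sp \<equiv> glue_sp V1 sp1 V2 sp2 C"

text \<open>The symmetry of reversing all edges: it exchanges the two parts and, in each of them,
  \<open>A\<close> with \<open>B\<close>. Statements on one part are transferred by it to the
  other.\<close>

lemma swap: "glued V2 sp2 B2 A2 V1 sp1 B1 A1 C"
  using b1.A_subset b1.B_subset b1.A_nonempty b1.B_nonempty b1.A_B_disjoint
    b2.A_subset b2.B_subset b2.A_nonempty b2.B_nonempty b2.A_B_disjoint C_eq C_B1 C_A2 C_nonempty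
  by unfold_locales auto

lemma sp_split_family: "split_family V sp"
proof
  fix P Q assume "sp P Q"
  then show "P \<union> Q = V"
  proof induction
    case base then show ?case by auto
  next
    case (ext1 P Q c) then show ?case using b1.sp_cover[of P Q] by auto
  next
    case (ext2 P Q c) then show ?case using b2.sp_cover[of P Q] by auto
  next
    case (both P Q R T c d) then show ?case using b1.sp_cover[of P Q] b2.sp_cover[of R T] by auto
  qed auto
next
  fix P Q assume "sp P Q"
  then show "P \<inter> Q = {}"
  proof induction
    case base then show ?case using C_eq by auto
  next
    case (ext1 P Q c) then show ?case
      using b1.sp_cover[of P Q] b1.sp_disjoint[of P Q] C_eq by auto
  next
    case (ext2 P Q c) then show ?case
      using b2.sp_cover[of P Q] b2.sp_disjoint[of P Q] C_eq by auto
  next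
    case (both P Q R T c d) then show ?case
      using b1.sp_cover[of P Q] b2.sp_cover[of R T] b1.sp_disjoint[of P Q] b2.sp_disjoint[of R T] C_eq
      by blast
  qed auto
qed (rule glue_sp.sym)

sublocale board V sp A B
proof -
  interpret split_family V sp by (rule sp_split_family)
  show "board V sp A B"
  proof unfold_locales
    show "A \<subseteq> V" using b1.A_subset b2.A_subset b1.A_B_disjoint C_B1 by blast
    show "B \<subseteq> V" using b1.B_subset b2.B_subset b2.A_B_disjoint C_A2 by blast
    show "A \<noteq> {}" using b1.A_nonempty by blast
    show "B \<noteq> {}" using b2.B_nonempty by blast
    have "A1 \<inter> B2 = {}" "(A2 - C) \<inter> (B1 - C) = {}"
      using b1.A_subset b2.A_subset b1.B_subset b2.B_subset C_eq b1.A_B_disjoint C_B1 by blast+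
    then show "A \<inter> B = {}" using b1.A_B_disjoint b2.A_B_disjoint by blast
  qed
qed

text \<open>Seen from one part, the other part hangs on the cut vertices through which the split was
  glued, so letters of an alternation lying there can be traded for cut vertices. The two parts see
  the cut from opposite sides, hence \<open>rev X\<close> in one word and \<open>X\<close> in the
  other.\<close>

lemma noncrossing_glue:
  assumes u: "set u \<subseteq> V1 - C" and v: "set v \<subseteq> V2 - C" and X: "set X = C"
    and nc1: "\<And>P Q. sp1 P Q \<Longrightarrow> noncrossing (u @ rev X) P Q"
    and nc2: "\<And>P Q. sp2 P Q \<Longrightarrow> noncrossing (X @ v) P Q"
    and sp: "sp P Q"
  shows "noncrossing (u @ v) P Q"
  using sp
proof induction
  case base
  have "x \<notin> V2" if "x \<in> set u" for x using that u C_eq by blast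
  moreover have "x \<notin> V1" if "x \<in> set v" for x using that v C_eq by blast
  ultimately show ?case
    unfolding noncrossing_def by (intro allI impI) (erule subseq_4_appendE; simp)
next
  case (sym P Q)
  then show ?case using noncrossing_commute by blast
next
  case (ext1 P Q c)
  have nc: "\<not> subseq [x, y, z, t] (u @ rev X)" if "x \<in> P" "y \<in> Q" "z \<in> P" "t \<in> Q" for x y z t
    using nc1[OF ext1(1)] that unfolding noncrossing_def by blast
  have nc': "\<not> subseq [x, y, z, t] (u @ rev X)" if "x \<in> Q" "y \<in> P" "z \<in> Q" "t \<in> P" for x y z t
    using nc1[OF ext1(1)] that unfolding noncrossing_def by blast
  have U: "x \<in> P" if "x \<in> set u" "x \<in> (P - C) \<union> (V2 - C)" for x using that u C_eq by blast
  have Wv: "x \<notin> Q - C" if "x \<in> set v" for x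
    using that v b1.sp_cover[OF ext1(1)] C_eq by blast
  have c: "c \<in> set (rev X)" using ext1 X by simp
  show ?case
    unfolding noncrossing_def
  proof (intro allI impI conjI notI; elim conjE)
    fix x y z t
    assume s: "subseq [x, y, z, t] (u @ v)" and m: "x \<in> (P - C) \<union> (V2 - C)" "y \<in> Q - C"
      "z \<in> (P - C) \<union> (V2 - C)" "t \<in> Q - C"
    \<comment> \<open>Letters of \<open>Q\<close> occur only in \<open>u\<close>; as the last letter
      is one of them, the whole alternation lies in \<open>u\<close>.\<close>
    have "t \<notin> set v" "y \<notin> set v" using Wv m by auto
    then have "subseq [x, y, z, t] u"
      using s by (elim subseq_4_appendE) blast+
    then have "subseq [x, y, z, t] (u @ rev X)" "x \<in> P" "z \<in> P"
      using U m subseq_4_in_set[of x y z t u] by (auto intro: subseq_rev_drop_many)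
    then show False using nc m by blast
  next
    fix x y z t
    assume s: "subseq [x, y, z, t] (u @ v)" and m: "x \<in> Q - C" "y \<in> (P - C) \<union> (V2 - C)"
      "z \<in> Q - C" "t \<in> (P - C) \<union> (V2 - C)"
    \<comment> \<open>Only the last letter can lie in \<open>v\<close>, and \<open>c\<close>, which
      is on its side of the split, takes its place.\<close>
    have "x \<notin> set v" "z \<notin> set v" using Wv m by auto
    then consider "subseq [x, y, z, t] u" | "subseq [x, y, z] u"
      using s by (elim subseq_4_appendE) blast+
    then show False
    proof cases
      case 1
      then have "subseq [x, y, z, t] (u @ rev X)" "y \<in> P" "t \<in> P"
        using U m subseq_4_in_set[of x y z t u] by (auto intro: subseq_rev_drop_many)
      then show False using nc' m by blast
    next
      case 2
      then have "subseq [x, y, z, c] (u @ rev X)" "y \<in> P"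
        using U m c subseq_3_in_set[OF 2] by (auto simp: subseq_4_append)
      then show False using nc' m ext1 by blast
    qed
  qed
next
  case (ext2 P Q c)
  have nc: "\<not> subseq [x, y, z, t] (X @ v)" if "x \<in> P" "y \<in> Q" "z \<in> P" "t \<in> Q" for x y z t
    using nc2[OF ext2(1)] that unfolding noncrossing_def by blast
  have nc': "\<not> subseq [x, y, z, t] (X @ v)" if "x \<in> Q" "y \<in> P" "z \<in> Q" "t \<in> P" for x y z t
    using nc2[OF ext2(1)] that unfolding noncrossing_def by blast
  have U: "x \<in> P" if "x \<in> set v" "x \<in> (P - C) \<union> (V1 - C)" for x using that v C_eq by blast
  have Wv: "x \<notin> Q - C" if "x \<in> set u" for x
    using that u b2.sp_cover[OF ext2(1)] C_eq by blast
  have c: "c \<in> set X" using ext2 X by simp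
  show ?case
    unfolding noncrossing_def
  proof (intro allI impI conjI notI; elim conjE)
    fix x y z t
    assume s: "subseq [x, y, z, t] (u @ v)" and m: "x \<in> (P - C) \<union> (V1 - C)" "y \<in> Q - C"
      "z \<in> (P - C) \<union> (V1 - C)" "t \<in> Q - C"
    have "t \<notin> set u" "y \<notin> set u" using Wv m by auto
    then consider "subseq [x, y, z, t] v" | "subseq [y, z, t] v"
      using s by (elim subseq_4_appendE) blast+
    then show False
    proof cases
      case 1
      then have "subseq [x, y, z, t] (X @ v)" "x \<in> P" "z \<in> P"
        using U m subseq_4_in_set[of x y z t v] by (auto intro: subseq_drop_many)
      then show False using nc m by blast
    next
      case 2
      then have "subseq [c, y, z, t] (X @ v)" "z \<in> P"
        using U m c subseq_3_in_set[OF 2] by (auto simp: subseq_4_append)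
      then show False using nc m ext2 by blast
    qed
  next
    fix x y z t
    assume s: "subseq [x, y, z, t] (u @ v)" and m: "x \<in> Q - C" "y \<in> (P - C) \<union> (V1 - C)"
      "z \<in> Q - C" "t \<in> (P - C) \<union> (V1 - C)"
    have "x \<notin> set u" "z \<notin> set u" using Wv m by auto
    then have "subseq [x, y, z, t] v"
      using s by (elim subseq_4_appendE) blast+
    then have "subseq [x, y, z, t] (X @ v)" "y \<in> P" "t \<in> P"
      using U m subseq_4_in_set[of x y z t v] by (auto intro: subseq_drop_many)
    then show False using nc' m by blast
  qed
next
  case (both P Q R T c d)
  \<comment> \<open>A letter lying alone on its side of the word is replaced by \<open>c\<close> or \<open>d\<close>.\<close>
  have main: False
    if sp: "sp1 P Q" "sp2 R T" and cd: "c \<in> P" "c \<in> R" "c \<in> C" "d \<in> Q" "d \<in> T" "d \<in> C"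
      and s: "subseq [x, y, z, t] (u @ v)"
      and m: "x \<in> (P - C) \<union> (R - C)" "y \<in> (Q - C) \<union> (T - C)"
        "z \<in> (P - C) \<union> (R - C)" "t \<in> (Q - C) \<union> (T - C)" for P Q R T c d x y z t
  proof -
    have cd': "c \<in> set X" "d \<in> set X" using cd X by auto
    have n1: "\<not> subseq [x, y, z, t] (u @ rev X)" if "x \<in> P" "y \<in> Q" "z \<in> P" "t \<in> Q" for x y z t
      using nc1[OF sp(1)] that unfolding noncrossing_def by blast
    have n2: "\<not> subseq [x, y, z, t] (X @ v)" if "x \<in> R" "y \<in> T" "z \<in> R" "t \<in> T" for x y z t
      using nc2[OF sp(2)] that unfolding noncrossing_def by blast
    have uP: "k \<in> P" if "k \<in> set u" "k \<in> (P - C) \<union> (R - C)" for k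
      using that u b2.sp_cover[OF sp(2)] C_eq by blast
    have uQ: "k \<in> Q" if "k \<in> set u" "k \<in> (Q - C) \<union> (T - C)" for k
      using that u b2.sp_cover[OF sp(2)] C_eq by blast
    have vR: "k \<in> R" if "k \<in> set v" "k \<in> (P - C) \<union> (R - C)" for k
      using that v b1.sp_cover[OF sp(1)] C_eq by blast
    have vT: "k \<in> T" if "k \<in> set v" "k \<in> (Q - C) \<union> (T - C)" for k
      using that v b1.sp_cover[OF sp(1)] C_eq by blast
    from s[unfolded subseq_4_append]
    consider "subseq [x, y, z, t] u" | "subseq [x, y, z] u" "t \<in> set v"
      | "subseq [x, y] u" "subseq [z, t] v" | "x \<in> set u" "subseq [y, z, t] v"
      | "subseq [x, y, z, t] v" by blast
    then show False
    proof cases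
      case 1
      note k = subseq_4_in_set[OF 1]
      show False
        using n1[OF uP[OF k(1) m(1)] uQ[OF k(2) m(2)] uP[OF k(3) m(3)] uQ[OF k(4) m(4)]]
          subseq_rev_drop_many[OF 1] by blast
    next
      case 2
      have "subseq [x, y, z, d] (u @ rev X)" using 2 cd' by (simp add: subseq_4_append)
      moreover note k = subseq_3_in_set[OF 2(1)]
      ultimately show False
        using n1[OF uP[OF k(1) m(1)] uQ[OF k(2) m(2)] uP[OF k(3) m(3)] cd(4)] by simp
    next
      case 3
      \<comment> \<open>With two letters in each word, the order of \<open>c\<close> and
        \<open>d\<close> in \<open>X\<close> decides which part is contradicted: \<open>c\<close>,
        \<open>d\<close>, \<open>z\<close>, \<open>t\<close> in \<open>X @ v\<close>, or
        \<open>x\<close>, \<open>y\<close>, \<open>c\<close>, \<open>d\<close> in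
        \<open>u @ rev X\<close>.\<close>
      have "c \<noteq> d" using cd b1.sp_disjoint[OF sp(1)] by blast
      then consider "subseq [c, d] X" | "subseq [d, c] X" using cd' subseq_2_total by metis
      then show False
      proof cases
        case 1
        then have "subseq [c, d, z, t] (X @ v)" using 3 by (simp add: subseq_4_append)
        moreover note k = subseq_2_in_set[OF 3(2)]
        ultimately show False
          using n2[OF cd(2) cd(5) vR[OF k(1) m(3)] vT[OF k(2) m(4)]] by simp
      next
        case 2
        then have "subseq [x, y, c, d] (u @ rev X)" using 3 by (simp add: subseq_4_append subseq_2_rev)
        moreover note k = subseq_2_in_set[OF 3(1)]
        ultimately show False
          using n1[OF uP[OF k(1) m(1)] uQ[OF k(2) m(2)] cd(1) cd(4)] by simp
      qed
    next
      case 4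
      have "subseq [c, y, z, t] (X @ v)" using 4 cd' by (simp add: subseq_4_append)
      moreover note k = subseq_3_in_set[OF 4(2)]
      ultimately show False
        using n2[OF cd(2) vT[OF k(1) m(2)] vR[OF k(2) m(3)] vT[OF k(3) m(4)]] by simp
    next
      case 5
      note k = subseq_4_in_set[OF 5]
      show False
        using n2[OF vR[OF k(1) m(1)] vT[OF k(2) m(2)] vR[OF k(3) m(3)] vT[OF k(4) m(4)]]
          subseq_drop_many[OF 5] by blast
    qed
  qed
  show ?case
    unfolding noncrossing_def
  proof (intro allI impI conjI notI; elim conjE)
    fix x y z t
    assume "subseq [x, y, z, t] (u @ v)"
    note m = main[OF both(1,2,3,4,5,6,7,8) this]
    assume "x \<in> (P - C) \<union> (R - C)" "y \<in> (Q - C) \<union> (T - C)"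
      "z \<in> (P - C) \<union> (R - C)" "t \<in> (Q - C) \<union> (T - C)"
    then show False by (rule m)
  next
    fix x y z t
    assume "subseq [x, y, z, t] (u @ v)"
    note m = main[OF b1.sp_sym[OF both(1)] b2.sp_sym[OF both(2)] both(6,7,8,3,4,5) this]
    assume "x \<in> (Q - C) \<union> (T - C)" "y \<in> (P - C) \<union> (R - C)"
      "z \<in> (Q - C) \<union> (T - C)" "t \<in> (P - C) \<union> (R - C)"
    then show False by (rule m)
  qed
qed

text \<open>Rotating the cyclic words of the two parts until the cut stands at one end brings them
  into the form required for gluing, with \<open>u = rev FB @ L1 @ rev PB\<close> and
  \<open>v = PA @ rev L2 @ FA\<close>.\<close>

lemma planar_glue:
  assumes compat: "FA = [] \<or> FB = []" "PA = [] \<or> PB = []"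
    and X: "set X = C" and L1: "set L1 = A1" and L2: "set L2 = B2"
    and FB: "set FB \<subseteq> B1 - C" "set PB \<subseteq> B1 - C" and FA: "set FA \<subseteq> A2 - C" "set PA \<subseteq> A2 - C"
    and p1: "planar sp1 L1 (FB @ X @ PB)" and p2: "planar sp2 (FA @ X @ PA) L2"
  shows "planar sp (FA @ L1 @ PA) (FB @ L2 @ PB)"
proof (rule noncrossing_imp_planar)
  fix P Q assume sp: "sp P Q"
  have ne: "X \<noteq> []" "L1 \<noteq> []" "L2 \<noteq> []" using X C_nonempty L1 L2 b1.A_nonempty b2.B_nonempty by auto
  have s1: "set L1 \<subseteq> V1" "set (FB @ X @ PB) \<subseteq> V1"
    using L1 X FB C_B1 b1.A_subset b1.B_subset by auto
  have s2: "set (FA @ X @ PA) \<subseteq> V2" "set L2 \<subseteq> V2"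
    using L2 X FA C_A2 b2.A_subset b2.B_subset by auto
  have nc1: "noncrossing ((rev FB @ L1 @ rev PB) @ rev X) P Q" if "sp1 P Q" for P Q
    using noncrossing_rotate[of "L1 @ rev PB @ rev X" "rev FB" P Q]
      b1.planar_imp_noncrossing[OF p1 s1 _ _ that] ne by simp
  have nc2: "noncrossing (X @ (PA @ rev L2 @ FA)) P Q" if "sp2 P Q" for P Q
    using noncrossing_rotate[of FA "X @ PA @ rev L2" P Q]
      b2.planar_imp_noncrossing[OF p2 s2 _ _ that] ne by simp
  have "set (rev FB @ L1 @ rev PB) \<subseteq> V1 - C" "set (PA @ rev L2 @ FA) \<subseteq> V2 - C"
    using L1 L2 FA FB s1 s2 b1.A_B_disjoint b2.A_B_disjoint C_B1 C_A2 by auto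
  from noncrossing_glue[OF this X nc1 nc2 sp]
  have nc: "noncrossing ((rev FB @ L1 @ rev PB) @ (PA @ rev L2 @ FA)) P Q" .
  then have nc': "noncrossing (FA @ rev FB @ L1 @ rev PB @ PA @ rev L2) P Q"
    using noncrossing_rotate[of "rev FB @ L1 @ rev PB @ PA @ rev L2" FA] by simp
  \<comment> \<open>The glued word differs from the desired one only in the order of the neighbours
    \<open>PA\<close>, \<open>rev PB\<close> and \<open>FA\<close>, \<open>rev FB\<close>; in each
    of these pairs one list is empty.\<close>
  then have nc'': "noncrossing (FA @ rev FB @ L1 @ PA @ rev PB @ rev L2) P Q"
    using compat(2) by auto
  show "noncrossing ((FA @ L1 @ PA) @ rev (FB @ L2 @ PB)) P Q"
    using compat(1)
  proof
    assume "FA = []"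
    then show ?thesis
      using nc'' noncrossing_rotate[of "rev FB" "L1 @ PA @ rev PB @ rev L2"] by simp
  next
    assume "FB = []"
    then show ?thesis using nc'' by simp
  qed
qed

end

section \<open>Decomposing shielded lists along a juncture\<close>

context glued
begin

lemma sp_ext1: "sp1 P Q \<Longrightarrow> c \<in> P \<Longrightarrow> c \<in> C \<Longrightarrow> sp ((P - C) \<union> (V2 - C)) (Q - C)"
  by (rule glue_sp.ext1)

lemma sp_base: "sp (V1 - C) (V2 - C)"
  by (rule glue_sp.base)

lemma sp_both:
  "sp1 P Q \<Longrightarrow> sp2 R T \<Longrightarrow> c \<in> P \<Longrightarrow> c \<in> R \<Longrightarrow> c \<in> C \<Longrightarrow> d \<in> Q \<Longrightarrow> d \<in> T \<Longrightarrow> d \<in> C \<Longrightarrow>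
    sp ((P - C) \<union> (R - C)) ((Q - C) \<union> (T - C))"
  by (rule glue_sp.both)

text \<open>Every split of the first part has a cut vertex on one of its sides, and the second part
  can be attached there.\<close>

lemma sp_ext1_cases:
  assumes "sp1 P Q"
  obtains "sp ((P - C) \<union> (V2 - C)) (Q - C)" | "sp (P - C) ((Q - C) \<union> (V2 - C))"
proof -
  obtain c where c: "c \<in> C" using C_nonempty by blast
  then have "c \<in> P \<union> Q" using b1.sp_cover[OF assms] C_eq by blast
  then show ?thesis
    using that sp_ext1[OF assms] sp_sym[OF sp_ext1[OF b1.sp_sym[OF assms]]] c by blast
qed

lemma in_V1: "x \<in> A1 \<Longrightarrow> x \<in> V1 - C" "x \<in> B1 \<Longrightarrow> x \<in> V1"
  using b1.A_subset b1.B_subset b1.A_B_disjoint C_B1 by auto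

lemma in_V2: "x \<in> B2 \<Longrightarrow> x \<in> V2 - C" "x \<in> A2 \<Longrightarrow> x \<in> V2"
  using b2.A_subset b2.B_subset b2.A_B_disjoint C_A2 by auto

text \<open>A violating \<open>t\<close> off the cut is still a terminal of the juncture. If
  \<open>t\<close> is a cut vertex, the second part is attached on its side and any \<open>e\<close>
  in \<open>B2\<close> takes over its role.\<close>

lemma shielded_restrict_A1:
  assumes "shielded sp B x y z" "x \<in> A1" "y \<in> A1" "z \<in> A1"
  shows "shielded sp1 B1 x y z"
proof (rule shieldedI)
  fix P Q t assume pq: "sp1 P Q" and m: "x \<in> P" "z \<in> P" "y \<in> Q" "t \<in> Q" "t \<in> B1"
  note nC = in_V1(1)[OF assms(2)] in_V1(1)[OF assms(3)] in_V1(1)[OF assms(4)]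
  show False
  proof (cases "t \<in> C")
    case True
    obtain e where e: "e \<in> B2" using b2.B_nonempty by blast
    have "sp (P - C) ((Q - C) \<union> (V2 - C))"
      using sp_sym[OF sp_ext1[OF b1.sp_sym[OF pq]]] m True by blast
    from shieldedD[OF assms(1) this, of e] show False using m nC e in_V2 by blast
  next
    case False
    from pq show False
    proof (cases rule: sp_ext1_cases)
      case 1 from shieldedD[OF assms(1) 1, of t] show False using m nC False by blast
    next
      case 2 from shieldedD[OF assms(1) 2, of t] show False using m nC False by blast
    qed
  qed
qed

lemma shielded_restrict_B1_3:
  assumes "shielded sp A x y z" "x \<in> B1 - C" "y \<in> B1 - C" "z \<in> B1 - C"
  shows "shielded sp1 A1 x y z"
proof (rule shieldedI)
  fix P Q t assume pq: "sp1 P Q" and m: "x \<in> P" "z \<in> P" "y \<in> Q" "t \<in> Q" "t \<in> A1"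
  from pq show False
  proof (cases rule: sp_ext1_cases)
    case 1 from shieldedD[OF assms(1) 1, of t] show False using m assms in_V1 by blast
  next
    case 2 from shieldedD[OF assms(1) 2, of t] show False using m assms in_V1 by blast
  qed
qed

text \<open>A single cut vertex of a triple may be represented by any \<open>e\<close> in
  \<open>B2\<close>: attaching the second part at \<open>c\<close> puts \<open>e\<close> on the side
  of \<open>c\<close>.\<close>

lemma shielded_restrict_B1_2:
  assumes "shielded sp A x y e" "x \<in> B1 - C" "y \<in> B1 - C" "e \<in> B2" "c \<in> C"
  shows "shielded sp1 A1 x y c"
proof (rule shieldedI)
  fix P Q t assume pq: "sp1 P Q" and m: "x \<in> P" "c \<in> P" "y \<in> Q" "t \<in> Q" "t \<in> A1"
  from shieldedD[OF assms(1) sp_ext1[OF pq m(2) assms(5)], of t] show False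
    using m assms in_V1 in_V2 by blast
qed

lemma shielded_restrict_B1_mid:
  assumes "shielded sp A x e y" "x \<in> B1 - C" "y \<in> B1 - C" "e \<in> B2" "c \<in> C"
  shows "shielded sp1 A1 x c y"
proof (rule shieldedI)
  fix P Q t assume pq: "sp1 P Q" and m: "x \<in> P" "y \<in> P" "c \<in> Q" "t \<in> Q" "t \<in> A1"
  from shieldedD[OF assms(1) sp_sym[OF sp_ext1[OF b1.sp_sym[OF pq] m(3) assms(5)]], of t] show False
    using m assms in_V1 in_V2 by blast
qed

text \<open>Two cut vertices on different sides cannot share a representative. A split of the second
  part that separates them is glued crosswise, \<open>P\<close> with \<open>T\<close> and
  \<open>Q\<close> with \<open>R\<close>, so that \<open>e\<close> follows \<open>c\<close> and
  \<open>e'\<close> follows \<open>c'\<close>.\<close>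

lemma shielded_restrict_B1_1:
  assumes "shielded sp A x e e'" "x \<in> B1 - C" "e \<in> B2" "e' \<in> B2" "c \<in> C" "c' \<in> C"
    and rt: "sp2 R T" "c \<in> R" "e \<in> R" "c' \<in> T" "e' \<in> T"
  shows "shielded sp1 A1 x c c'"
proof (rule shieldedI)
  fix P Q t assume pq: "sp1 P Q" and m: "x \<in> P" "c' \<in> P" "c \<in> Q" "t \<in> Q" "t \<in> A1"
  have "sp ((P - C) \<union> (T - C)) ((Q - C) \<union> (R - C))"
    using sp_both[OF pq b2.sp_sym[OF rt(1)]] m rt assms(5,6) by blast
  from shieldedD[OF assms(1) this, of t] show False
    using m assms rt in_V1 in_V2 by blast
qed

text \<open>The letters of \<open>A1\<close> are contiguous because of the base split: a letter of
  the second part between two of them would be on the same side as \<open>B2\<close>.\<close>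

lemma shielded_list_A_decomp:
  assumes "set LA = A" "shielded_list sp B LA"
  obtains FA L1 PA where "LA = FA @ L1 @ PA" "set L1 = A1" "set FA \<union> set PA = A2 - C"
    "shielded_list sp1 B1 L1"
proof -
  have "y \<in> A1" if s: "subseq [x, y, z] LA" "x \<in> A1" "z \<in> A1" for x y z
  proof (rule ccontr)
    assume "y \<notin> A1"
    then have y: "y \<in> V2 - C" using subseq_3_in_set[OF s(1)] assms(1) in_V2 by blast
    obtain e where "e \<in> B2" using b2.B_nonempty by blast
    then show False
      using shieldedD[OF shielded_listD[OF assms(2) s(1)] sp_base, of e] s y in_V1 in_V2 by blast
  qed
  then obtain FA L1 PA where l: "LA = FA @ L1 @ PA" "set L1 \<subseteq> A1" "set FA \<inter> A1 = {}" "set PA \<inter> A1 = {}"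
    using contiguous_decomposition[of LA A1] by metis
  have "A1 \<inter> (A2 - C) = {}" using C_eq b1.A_subset b2.A_subset by blast
  then have 1: "set L1 = A1" and 2: "set FA \<union> set PA = A2 - C"
    using l assms(1) by auto
  have "shielded_list sp B L1"
    using shielded_list_subseq[OF assms(2)] l by (simp add: subseq_drop_many subseq_rev_drop_many)
  then have "shielded_list sp1 B1 L1"
    unfolding shielded_list_def using shielded_restrict_A1 subseq_3_in_set 1 by metis
  then show ?thesis using that l 1 2 by blast
qed

text \<open>Triples of \<open>FB @ X\<close> with two letters in \<open>FB\<close> are shielded by
  \<open>LB\<close>, those with at most one already by \<open>F0 @ X\<close>, since the order of
  \<open>F0\<close> does not matter to them. The orientation against \<open>L1\<close> is fixed by
  the overhanging letters on both sides.\<close>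

lemma planar_one_sided:
  assumes LA: "shielded_list sp B (L1 @ PA)" and LB: "shielded_list sp A (FB @ L2)"
    and sets: "set L1 = A1" "set PA = A2 - C" "set FB = B1 - C" "set L2 = B2" "set X = C"
    and ne: "PA \<noteq> []" "FB \<noteq> []"
    and F0: "set F0 = B1 - C" "shielded_list sp1 A1 (F0 @ X)"
    and L1: "shielded_list sp1 B1 L1"
  shows "planar sp1 L1 (FB @ X)"
proof -
  have set_FBX: "set (FB @ X) = B1" using sets C_B1 by auto
  obtain e where e: "e \<in> B2" using b2.B_nonempty by blast
  obtain c0 where c0: "c0 \<in> C" using C_nonempty by blast
  obtain z where z: "z \<in> set PA" using ne(1) by (cases PA) auto
  obtain k where k: "k \<in> set FB" using ne(2) by (cases FB) auto
  have grd: "shielded_list sp1 A1 (FB @ X)"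
    unfolding shielded_list_def
  proof (intro allI impI)
    fix x y w assume "subseq [x, y, w] (FB @ X)"
    then consider "subseq [x, y, w] FB" | "subseq [x, y] FB" "w \<in> C"
      | "x \<in> set FB" "subseq [y, w] X" | "subseq [x, y, w] X"
      unfolding subseq_3_append sets(5) by blast
    then show "shielded sp1 A1 x y w"
    proof cases
      case 1
      then have "shielded sp A x y w" using shielded_listD[OF LB] by (simp add: subseq_3_append)
      then show ?thesis using shielded_restrict_B1_3 subseq_3_in_set[OF 1] sets by blast
    next
      case 2
      then have "shielded sp A x y e" using shielded_listD[OF LB] e sets by (simp add: subseq_3_append)
      then show ?thesis using shielded_restrict_B1_2 subseq_2_in_set[OF 2(1)] sets e 2 by blast
    next
      case 3
      then show ?thesis using shielded_listD[OF F0(2)] sets F0(1) by (simp add: subseq_3_append)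
    next
      case 4
      then show ?thesis using shielded_listD[OF F0(2)] by (simp add: subseq_3_append)
    qed
  qed
  have "uncrossed sp1 L1 (FB @ X)"
    unfolding uncrossed_def
  proof (intro allI impI notI)
    fix P Q x y a b
    assume pq: "sp1 P Q" and m: "x \<in> P" "a \<in> P" "y \<in> Q" "b \<in> Q"
      and xy: "subseq [x, y] L1" and ba: "subseq [b, a] (FB @ X)"
    have xyA: "x \<in> A1" "y \<in> A1" using subseq_2_in_set[OF xy] sets by auto
    \<comment> \<open>Attaching the second part at \<open>c\<close> puts \<open>z\<close> into
      \<open>P\<close>, so \<open>x\<close>, \<open>y\<close>, \<open>z\<close> is a shielded triple
      with only \<open>y\<close> in \<open>Q\<close>; a terminal \<open>k\<close> off the cut left
      in \<open>Q\<close> violates it.\<close>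
    have key: False if c: "c \<in> P" "c \<in> C" and b: "k \<in> Q" "k \<in> B1 - C" for c k
    proof -
      have "shielded sp B x y z" using shielded_listD[OF LA] xy z by (simp add: subseq_3_append)
      from shieldedD[OF this sp_ext1[OF pq c], of k]
      show False using m xyA in_V1 z sets in_V2 b by blast
    qed
    note sh = shieldedD[OF shielded_listD[OF grd] pq] shieldedD[OF shielded_listD[OF grd] b1.sp_sym[OF pq]]
    from ba consider "a \<in> C" "b \<in> B1 - C" | "a \<in> B1 - C" "b \<in> B1 - C" "subseq [b, a] FB"
      | "a \<in> C" "b \<in> C" "subseq [b, a] X"
      unfolding subseq_2_append using sets subseq_2_in_set by metis
    then show False
    proof cases
      case 1 then show False using key m by blast
    next
      case 2
      \<comment> \<open>A cut vertex in \<open>P\<close> would fall under \<open>key\<close> with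
        \<open>b\<close>; in \<open>Q\<close> it completes a forbidden triple.\<close>
      have "c0 \<in> Q"
        using key 2 m c0 b1.sp_cover[OF pq] C_eq by blast
      moreover have "subseq [b, a, c0] (FB @ X)" using 2 c0 sets by (simp add: subseq_3_append)
      ultimately show False using sh(2) m xyA by blast
    next
      case 3
      \<comment> \<open>Dually, \<open>k\<close> in \<open>Q\<close> falls under \<open>key\<close>
        with the cut vertex \<open>a\<close>, and \<open>k\<close> in \<open>P\<close> completes a
        forbidden triple.\<close>
      have "k \<in> P"
        using key 3 m k sets b1.sp_cover[OF pq] b1.B_subset by blast
      moreover have "subseq [k, b, a] (FB @ X)" using 3 k by (simp add: subseq_3_append)
      ultimately show False using sh(1) m xyA by blast
    qed
  qed
  then show ?thesis unfolding planar_def set_FBX sets(1) using grd L1 by blast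
qed

text \<open>A terminal off the cut tolerates standing to the right of \<open>X\<close> iff it tolerates standing to the
  left of \<open>rev X\<close>, so one predicate serves both sides.\<close>

definition tolerates_left :: "'v list \<Rightarrow> 'v \<Rightarrow> bool" where
  "tolerates_left X x \<longleftrightarrow> (\<forall>c c'. subseq [c, c'] X \<longrightarrow> shielded sp1 A1 x c c')"

text \<open>A triple with at most one cut vertex is inherited from \<open>LB\<close>, with some
  \<open>e\<close> in \<open>B2\<close> for the cut vertex. Two cut vertices are left to the
  tolerance assumptions, three to \<open>X\<close>.\<close>

lemma shielded_list_surround:
  assumes LB: "shielded_list sp A (FB @ L2 @ PB)"
    and sets: "set FB \<subseteq> B1 - C" "set PB \<subseteq> B1 - C" "set L2 = B2" "set X = C"
    and X: "shielded_list sp1 A1 X"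
    and l: "\<And>x. x \<in> set FB \<Longrightarrow> tolerates_left X x"
    and r: "\<And>x. x \<in> set PB \<Longrightarrow> tolerates_left (rev X) x"
  shows "shielded_list sp1 A1 (FB @ X @ PB)"
  unfolding shielded_list_def
proof (intro allI impI)
  obtain e where e: "e \<in> B2" using b2.B_nonempty by blast
  have sh: "shielded sp A x y w" if "subseq [x, y, w] (FB @ L2 @ PB)" for x y w
    using shielded_listD[OF LB that] .
  fix x y w assume "subseq [x, y, w] (FB @ X @ PB)"
  then consider "subseq [x, y, w] (FB @ PB)" | "subseq [x, y] FB" "w \<in> C"
    | "x \<in> set FB" "y \<in> C" "w \<in> set PB" | "x \<in> C" "subseq [y, w] PB"
    | "x \<in> set FB" "subseq [y, w] X" | "subseq [x, y, w] X" | "subseq [x, y] X" "w \<in> set PB"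
    unfolding subseq_3_append subseq_2_append set_append sets(4) by blast
  then show "shielded sp1 A1 x y w"
  proof cases
    case 1
    then have "shielded sp A x y w" by (intro sh) (auto simp: subseq_3_append subseq_2_append)
    moreover have "{x, y, w} \<subseteq> B1 - C" using subseq_3_in_set[OF 1] sets by auto
    ultimately show ?thesis using shielded_restrict_B1_3 by blast
  next
    case 2
    then have "shielded sp A x y e" using e sets by (intro sh) (auto simp: subseq_3_append)
    then show ?thesis using shielded_restrict_B1_2 subseq_2_in_set[OF 2(1)] sets e 2 by blast
  next
    case 3
    then have "shielded sp A x e w" using e sets by (intro sh) (auto simp: subseq_3_append subseq_2_append)
    then show ?thesis using shielded_restrict_B1_mid sets e 3 by blast
  next
    case 4
    then have "shielded sp A e y w" using e sets by (intro sh) (auto simp: subseq_3_append)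
    then have "shielded sp A w y e" using shielded_commute by metis
    then have "shielded sp1 A1 w y x"
      using shielded_restrict_B1_2 subseq_2_in_set[OF 4(2)] sets e 4 by blast
    then show ?thesis using shielded_commute by metis
  next
    case 5 then show ?thesis using l unfolding tolerates_left_def by blast
  next
    case 6 then show ?thesis using shielded_listD[OF X] by blast
  next
    case 7 then show ?thesis using r shielded_commute unfolding tolerates_left_def subseq_2_rev by metis
  qed
qed

text \<open>If a split separates \<open>c\<close> from \<open>c'\<close> with \<open>B2\<close> on
  both sides, planarity of \<open>X\<close> and \<open>L2\<close> orders the representatives
  \<open>e\<close>, \<open>e'\<close> like \<open>c\<close>, \<open>c'\<close>, and
  \<open>LB\<close> shields them. Otherwise a third cut vertex \<open>d\<close>, separated from
  both, mediates.\<close>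

lemma tolerates_left_if_separated:
  assumes LB: "shielded_list sp A (FB @ L2 @ PB)"
    and sets: "set L2 = B2" "set X = C" and dX: "distinct X"
    and A2: "A2 = C" and p2: "planar sp2 X L2"
    and sep: "\<not> unlinked sp2 A2 B2"
    and G: "shielded_list sp1 A1 (F0 @ X @ P0)"
    and x: "x \<in> set FB" "x \<in> B1 - C" "x \<in> set F0 \<union> set P0"
  shows "tolerates_left X x"
proof (cases "x \<in> set F0")
  case True
  then show ?thesis unfolding tolerates_left_def
    using shielded_listD[OF G] by (simp add: subseq_3_append subseq_2_append)
next
  case False
  then have xP: "x \<in> set P0" using x by blast
  have G3: "shielded sp1 A1 c c' x" if "subseq [c, c'] X" for c c'
    using shielded_listD[OF G] xP that by (simp add: subseq_3_append)
  have X3: "shielded sp2 B2 c d c'" if "subseq [c, d, c'] X" for c d c'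
    using p2 that unfolding planar_def sets(1) by (blast dest: shielded_listD)
  have inV2: "c \<in> V2" if "c \<in> C" for c using that C_eq by blast
  have inV1: "c \<in> V1" if "c \<in> C" for c using that C_eq by blast
  have dis: "shielded sp1 A1 x c c'"
    if s: "subseq [c, c'] X" and d: "separated sp2 B2 c c'" for c c'
  proof -
    obtain R T e e' where rt: "sp2 R T" "c \<in> R" "c' \<in> T" "e \<in> R" "e' \<in> T" "e \<in> B2" "e' \<in> B2"
      using d unfolding separated_def by blast
    have "e \<noteq> e'" using rt b2.sp_disjoint by blast
    moreover have "\<not> subseq [e', e] L2"
      using p2 rt s unfolding planar_def uncrossed_def by blast
    ultimately have "subseq [e, e'] L2" using subseq_2_total rt sets by metis
    then have "shielded sp A x e e'"
      using shielded_listD[OF LB] x by (simp add: subseq_3_append subseq_2_append)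
    then show ?thesis using shielded_restrict_B1_1 rt x subseq_2_in_set[OF s] sets by blast
  qed
  show ?thesis
    unfolding tolerates_left_def
  proof (intro allI impI)
    fix c c' assume cc: "subseq [c, c'] X"
    have cC: "c \<in> C" "c' \<in> C" using subseq_2_in_set[OF cc] sets by auto
    show "shielded sp1 A1 x c c'"
    proof (cases "separated sp2 B2 c c'")
      case True then show ?thesis using dis cc by blast
    next
      case nsep: False
      then have nsep': "\<not> separated sp2 B2 c' c" using b2.separated_commute by blast
      \<comment> \<open>A split dividing both \<open>A2\<close> and \<open>B2\<close> exists by
        linkedness. It does not separate \<open>c\<close> from \<open>c'\<close>, so it has another
        cut vertex \<open>d\<close> across from them.\<close>
      obtain R T where rt: "sp2 R T" "R \<inter> A2 \<noteq> {}" "T \<inter> A2 \<noteq> {}" "R \<inter> B2 \<noteq> {}" "T \<inter> B2 \<noteq> {}"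
        using sep unfolding unlinked_def by blast
      have "c \<in> R \<union> T" "c' \<in> R \<union> T" using b2.sp_cover[OF rt(1)] cC inV2 by auto
      with nsep rt b2.sp_sym[OF rt(1)]
      obtain R T d where rt: "sp2 R T" "c \<in> R" "c' \<in> R" "d \<in> T" "d \<in> C" "R \<inter> B2 \<noteq> {}" "T \<inter> B2 \<noteq> {}"
        unfolding separated_def A2 by blast
      have sd: "separated sp2 B2 c d" "separated sp2 B2 c' d"
        unfolding separated_def using rt by blast+
      have sd': "separated sp2 B2 d c" "separated sp2 B2 d c'"
        using sd b2.separated_commute by blast+
      have dne: "d \<noteq> c" "d \<noteq> c'" using rt b2.sp_disjoint[OF rt(1)] by auto
      have ord: "subseq [d, c] X \<or> subseq [c, d] X" "subseq [d, c'] X \<or> subseq [c', d] X"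
        using subseq_2_total dne rt(5) cC sets by metis+
      have "\<not> (subseq [c, d] X \<and> subseq [d, c'] X)"
      proof
        assume "subseq [c, d] X \<and> subseq [d, c'] X"
        then have "shielded sp2 B2 c d c'" using X3 subseq_2_trans[OF dX] by blast
        then show False using rt unfolding shielded_def by blast
      qed
      moreover have "subseq [d, c'] X" if "subseq [d, c] X"
      proof -
        have "subseq [d, c, c'] X" using subseq_2_trans[OF dX that cc] .
        then show ?thesis using subseq_order.order_trans[of "[d, c']" "[d, c, c']"] by simp
      qed
      ultimately consider "subseq [d, c] X" "subseq [d, c'] X" | "subseq [c, d] X" "subseq [c', d] X"
        using ord by blast
      then show ?thesis
      proof cases
        case 1
        \<comment> \<open>Whichever side of a violating split contains \<open>d\<close>, it
          contradicts the shielding of \<open>d\<close>, \<open>c\<close>, \<open>x\<close> or that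
          of \<open>x\<close>, \<open>d\<close>, \<open>c'\<close>.\<close>
        note s = shieldedD[OF G3[OF 1(1)]] shieldedD[OF dis[OF 1(2) sd'(2)]]
        show ?thesis
        proof (rule shieldedI)
          fix P Q t assume pq: "sp1 P Q" "x \<in> P" "c' \<in> P" "c \<in> Q" "t \<in> Q" "t \<in> A1"
          then show False
            using s(1)[of P Q t] s(2)[of P Q t] b1.sp_cover[OF pq(1)] inV1[OF rt(5)] by blast
        qed
      next
        case 2
        note s = shieldedD[OF G3[OF 2(2)]] shieldedD[OF dis[OF 2(1) sd(1)]]
        show ?thesis
        proof (rule shieldedI)
          fix P Q t assume pq: "sp1 P Q" "x \<in> P" "c' \<in> P" "c \<in> Q" "t \<in> Q" "t \<in> A1"
          then show False
            using s(1)[of P Q t] s(2)[of P Q t] b1.sp_cover[OF pq(1)] inV1[OF rt(5)] by blast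
        qed
      qed
    qed
  qed
qed

text \<open>In a split witnessing that \<open>x\<close> is not tolerated, \<open>y\<close> on the
  side of \<open>x\<close> contradicts \<open>mid\<close>, and \<open>y\<close> on the other side
  contradicts \<open>first\<close>.\<close>

lemma tolerates_clash:
  assumes "\<not> tolerates_left X x \<or> \<not> tolerates_left (rev X) x"
    and "y \<in> V1" and C: "set X = C"
    and mid: "\<And>c. c \<in> C \<Longrightarrow> shielded sp1 A1 x c y"
    and first: "\<And>c. c \<in> C \<Longrightarrow> shielded sp1 A1 x y c"
  shows False
proof -
  obtain c c' where c: "c \<in> C" "c' \<in> C" "\<not> shielded sp1 A1 x c c'"
    using assms(1) C subseq_2_in_set unfolding tolerates_left_def subseq_2_rev by metis
  then obtain P Q t where pq: "sp1 P Q" "x \<in> P" "c' \<in> P" "c \<in> Q" "t \<in> Q" "t \<in> A1"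
    unfolding shielded_def by blast
  have "y \<in> P \<union> Q" using b1.sp_cover[OF pq(1)] assms(2) by blast
  then show False
    using shieldedD[OF mid[OF c(1)] pq(1)] shieldedD[OF first[OF c(2)] pq(1)] pq by blast
qed

text \<open>If \<open>u\<close> rules out one orientation and \<open>v\<close> the other, then one
  of the two lists \<open>FB @ L2 @ PB\<close> and \<open>F0 @ X @ P0\<close> has \<open>u\<close>
  and \<open>v\<close> on opposite sides of its middle block, the other one on the same side.
  Together they put each cut vertex between \<open>u\<close> and \<open>v\<close> and also outside,
  which clashes.\<close>

lemma tolerates_orientation:
  assumes LB: "shielded_list sp A (FB @ L2 @ PB)"
    and sets: "set L2 = B2" "set X = C" "set FB \<union> set PB = B1 - C" "set F0 \<union> set P0 = B1 - C"
    and FP: "set FB \<inter> set PB = {}"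
    and G: "shielded_list sp1 A1 (F0 @ X @ P0)"
  obtains "\<And>x. x \<in> set FB \<Longrightarrow> tolerates_left X x" "\<And>x. x \<in> set PB \<Longrightarrow> tolerates_left (rev X) x"
  | "\<And>x. x \<in> set FB \<Longrightarrow> tolerates_left (rev X) x" "\<And>x. x \<in> set PB \<Longrightarrow> tolerates_left X x"
proof (rule ccontr)
  assume "\<not> thesis"
  have "\<not> ((\<forall>x\<in>set FB. tolerates_left X x) \<and> (\<forall>x\<in>set PB. tolerates_left (rev X) x))"
    using that(1) \<open>\<not> thesis\<close> by blast
  moreover have "\<not> ((\<forall>x\<in>set FB. tolerates_left (rev X) x) \<and> (\<forall>x\<in>set PB. tolerates_left X x))"
    using that(2) \<open>\<not> thesis\<close> by blast
  ultimately obtain u v where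
    u: "u \<in> set FB \<and> \<not> tolerates_left X u \<or> u \<in> set PB \<and> \<not> tolerates_left (rev X) u" and
    v: "v \<in> set FB \<and> \<not> tolerates_left (rev X) v \<or> v \<in> set PB \<and> \<not> tolerates_left X v"
    by blast
  obtain e where e: "e \<in> B2" using b2.B_nonempty by blast
  have uv: "u \<in> B1 - C" "v \<in> B1 - C" using u v sets by auto
  then have uvV: "u \<in> V1" "v \<in> V1" using in_V1 by auto
  have uv0: "u \<in> set F0 \<union> set P0" "v \<in> set F0 \<union> set P0" using uv sets by auto
  have l0: "tolerates_left X x" if "x \<in> set F0" for x
    unfolding tolerates_left_def using shielded_listD[OF G] that
    by (simp add: subseq_3_append subseq_2_append)
  have r0: "tolerates_left (rev X) x" if "x \<in> set P0" for x
    unfolding tolerates_left_def subseq_2_rev using shielded_listD[OF G] that shielded_commute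
    by (metis subseq_3_append subseq_2_append)
  have m0: "shielded sp1 A1 x c y" if "x \<in> set F0" "y \<in> set P0" "c \<in> C" for x y c
    using shielded_listD[OF G] that sets by (simp add: subseq_3_append subseq_2_append)
  have ff0: "shielded sp1 A1 x y c" if "subseq [x, y] F0" "c \<in> C" for x y c
    using shielded_listD[OF G] that sets by (simp add: subseq_3_append)
  have pp0: "shielded sp1 A1 y x c" if "subseq [x, y] P0" "c \<in> C" for x y c
    using shielded_listD[OF G, of c x y] that sets shielded_commute[of sp1 A1 c x y]
    by (simp add: subseq_3_append)
  have m: "shielded sp1 A1 x c y" if "x \<in> set FB" "y \<in> set PB" "c \<in> C" for x y c
  proof -
    have "shielded sp A x e y"
      using shielded_listD[OF LB] that sets e by (simp add: subseq_3_append subseq_2_append)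
    then show ?thesis using shielded_restrict_B1_mid that sets e by blast
  qed
  have ff: "shielded sp1 A1 x y c" if "subseq [x, y] FB" "c \<in> C" for x y c
  proof -
    have "shielded sp A x y e"
      using shielded_listD[OF LB] that sets e by (simp add: subseq_3_append)
    then show ?thesis using shielded_restrict_B1_2 that sets e subseq_2_in_set[OF that(1)] by blast
  qed
  have pp: "shielded sp1 A1 y x c" if "subseq [x, y] PB" "c \<in> C" for x y c
  proof -
    have "shielded sp A e x y"
      using shielded_listD[OF LB] that sets e by (simp add: subseq_3_append)
    then have "shielded sp A y x e" using shielded_commute by metis
    then show ?thesis using shielded_restrict_B1_2 that sets e subseq_2_in_set[OF that(1)] by blast
  qed
  have bad: "\<not> tolerates_left X u \<or> \<not> tolerates_left (rev X) u"
    "\<not> tolerates_left X v \<or> \<not> tolerates_left (rev X) v" using u v by auto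
  have clash: False if "\<And>c. c \<in> C \<Longrightarrow> shielded sp1 A1 u c v"
    "(\<forall>c\<in>C. shielded sp1 A1 u v c) \<or> (\<forall>c\<in>C. shielded sp1 A1 v u c)"
    using tolerates_clash[OF bad(1) uvV(2) sets(2)] tolerates_clash[OF bad(2) uvV(1) sets(2)] that
      shielded_commute by metis
  have order: "(\<forall>c\<in>C. shielded sp1 A1 u v c) \<or> (\<forall>c\<in>C. shielded sp1 A1 v u c)"
    if "l \<in> {FB, PB, F0, P0}" "u \<in> set l" "v \<in> set l" "u \<noteq> v" for l
    using subseq_2_total[OF that(2-4)] that(1) ff pp ff0 pp0 by auto
  consider "u \<in> set FB" "v \<in> set FB" "\<not> tolerates_left X u" "\<not> tolerates_left (rev X) v"
    | "u \<in> set PB" "v \<in> set PB" "\<not> tolerates_left (rev X) u" "\<not> tolerates_left X v"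
    | "u \<in> set FB" "v \<in> set PB" "\<not> tolerates_left X u" "\<not> tolerates_left X v"
    | "u \<in> set PB" "v \<in> set FB" "\<not> tolerates_left (rev X) u" "\<not> tolerates_left (rev X) v"
    using u v by blast
  then show False
  proof cases
    case 1
    then have uvP: "u \<in> set P0" "v \<in> set F0" using uv0 l0 r0 by auto
    have "u \<noteq> v" using 1 l0 uvP by blast
    then show False using clash m0 shielded_commute order[of FB] 1 uvP by (metis insertCI)
  next
    case 2
    then have uvP: "u \<in> set F0" "v \<in> set P0" using uv0 l0 r0 by auto
    have "u \<noteq> v" using 2 l0 uvP by blast
    then show False using clash m0 shielded_commute order[of PB] 2 uvP by (metis insertCI)
  next
    case 3
    then have uvP: "u \<in> set P0" "v \<in> set P0" using uv0 l0 r0 by auto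
    have "u \<noteq> v" using 3 FP by blast
    then show False using clash m order[of P0] 3 uvP by (metis insertCI)
  next
    case 4
    then have uvP: "u \<in> set F0" "v \<in> set F0" using uv0 l0 r0 by auto
    have "u \<noteq> v" using 4 FP by blast
    then show False using clash m order[of F0] 4 uvP shielded_commute by (metis insertCI)
  qed
qed

end

section \<open>Lists of the two parts recovered from lists of the juncture\<close>

definition orientable :: "('v set \<Rightarrow> 'v set \<Rightarrow> bool) \<Rightarrow> 'v set \<Rightarrow> 'v set \<Rightarrow> bool" where
  "orientable sp A B \<longleftrightarrow>
     (\<forall>LA LB. list_of LA A \<longrightarrow> list_of LB B \<longrightarrow> shielded_list sp B LA \<longrightarrow> shielded_list sp A LB \<longrightarrow>
        planar sp LA LB \<or> planar sp (rev LA) LB)"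

lemma list_of_rev: "list_of (rev l) S \<longleftrightarrow> list_of l S"
  unfolding list_of_def by simp

lemma (in split_family) orientable_commute: "orientable sp A B \<longleftrightarrow> orientable sp B A"
  unfolding orientable_def using planar_commute planar_rev_left by blast

context glued
begin

lemma sp_swap: "glue_sp V2 sp2 V1 sp1 C = sp"
  by (rule glue_sp_swap)

lemmas shielded_list_B_decomp = glued.shielded_list_A_decomp[OF swap, unfolded sp_swap]
lemmas planar_one_sided_swap = glued.planar_one_sided[OF swap, unfolded sp_swap]

lemma partsI:
  assumes "planar sp1 L1 (FB @ X @ PB)" "planar sp2 (FA @ X @ PA) L2"
    "FA = [] \<or> FB = []" "PA = [] \<or> PB = []" "set X = C" "distinct X" "set L1 = A1" "set L2 = B2"
    "LA = FA @ L1 @ PA" "LB = FB @ L2 @ PB"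
  shows "parts A1 sp1 B2 sp2 C LA LB"
  unfolding parts_def using assms by blast

lemma partsE:
  assumes "parts A1 sp1 B2 sp2 C LA LB" "list_of LA A" "list_of LB B"
  obtains FA L1 PA FB L2 PB X where "LA = FA @ L1 @ PA" "LB = FB @ L2 @ PB"
    "FA = [] \<or> FB = []" "PA = [] \<or> PB = []" "set X = C" "distinct X" "set L1 = A1" "set L2 = B2"
    "set FA \<union> set PA = A2 - C" "set FB \<union> set PB = B1 - C"
    "planar sp1 L1 (FB @ X @ PB)" "planar sp2 (FA @ X @ PA) L2"
proof -
  obtain FA L1 PA FB L2 PB X where *: "LA = FA @ L1 @ PA" "LB = FB @ L2 @ PB"
    "FA = [] \<or> FB = []" "PA = [] \<or> PB = []" "set X = C" "distinct X" "set L1 = A1" "set L2 = B2"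
    "planar sp1 L1 (FB @ X @ PB)" "planar sp2 (FA @ X @ PA) L2"
    using assms(1) unfolding parts_def by blast
  have "A1 \<inter> (A2 - C) = {}" "B2 \<inter> (B1 - C) = {}"
    using C_eq b1.A_subset b2.A_subset b1.B_subset b2.B_subset by blast+
  moreover have "(set FA \<union> set PA) \<union> A1 = A" "(set FA \<union> set PA) \<inter> A1 = {}"
    "(set FB \<union> set PB) \<union> B2 = B" "(set FB \<union> set PB) \<inter> B2 = {}"
    using assms(2,3) * unfolding list_of_def by auto
  ultimately have "set FA \<union> set PA = A2 - C" "set FB \<union> set PB = B1 - C" by blast+
  then show ?thesis using that * by blast
qed

lemma parts_rev:
  assumes "parts A1 sp1 B2 sp2 C LA LB"
  shows "parts A1 sp1 B2 sp2 C (rev LA) (rev LB)"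
proof -
  obtain FA L1 PA FB L2 PB X where *: "LA = FA @ L1 @ PA" "LB = FB @ L2 @ PB"
    "FA = [] \<or> FB = []" "PA = [] \<or> PB = []" "set X = C" "distinct X" "set L1 = A1" "set L2 = B2"
    "planar sp1 L1 (FB @ X @ PB)" "planar sp2 (FA @ X @ PA) L2"
    using assms unfolding parts_def by blast
  have "planar sp1 (rev L1) (rev PB @ rev X @ rev FB)" "planar sp2 (rev PA @ rev X @ rev FA) (rev L2)"
    using b1.planar_rev[of L1 "FB @ X @ PB"] b2.planar_rev[of "FA @ X @ PA" L2] * by auto
  then show ?thesis
    by (rule partsI[where ?L1.0 = "rev L1" and ?L2.0 = "rev L2"]) (use * in auto)
qed

lemma planar_if_parts:
  assumes "parts A1 sp1 B2 sp2 C LA LB" "list_of LA A" "list_of LB B"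
  shows "planar sp LA LB"
  using assms
proof (rule partsE)
  fix FA L1 PA FB L2 PB X
  assume *: "LA = FA @ L1 @ PA" "LB = FB @ L2 @ PB"
    "FA = [] \<or> FB = []" "PA = [] \<or> PB = []" "set X = C" "distinct X" "set L1 = A1" "set L2 = B2"
    "set FA \<union> set PA = A2 - C" "set FB \<union> set PB = B1 - C"
    "planar sp1 L1 (FB @ X @ PB)" "planar sp2 (FA @ X @ PA) L2"
  then have "set FB \<subseteq> B1 - C" "set PB \<subseteq> B1 - C" "set FA \<subseteq> A2 - C" "set PA \<subseteq> A2 - C" by auto
  then show ?thesis unfolding *(1,2) by (intro planar_glue[OF *(3-5,7,8)] *(11,12))
qed

text \<open>If \<open>A2\<close> and \<open>B2\<close> are unlinked, \<open>L2\<close> accepts both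
  orientations of \<open>X\<close>, so the overhanging letters \<open>FB\<close>, \<open>PB\<close>
  may choose; otherwise \<open>L2\<close> forces the orientation and the overhanging letters
  tolerate it. \<open>LA\<close> is oriented last, which is where its reversal may be
  needed.\<close>

lemma parts_if_no_extra:
  assumes A2: "A2 = C"
    and LA: "list_of LA A" "shielded_list sp B LA" and LB: "list_of LB B" "shielded_list sp A LB"
    and G: "list_of (F @ X @ P) B1" "shielded_list sp1 A1 (F @ X @ P)"
    and X: "set X = C" "shielded_list sp2 B2 X"
    and o1: "orientable sp1 A1 B1" and o2: "orientable sp2 A2 B2"
  shows "parts A1 sp1 B2 sp2 C LA LB \<or> parts A1 sp1 B2 sp2 C (rev LA) LB"
proof -
  have lA: "set LA = A1" using LA A2 unfolding list_of_def by auto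
  have B': "set LB = B" "distinct LB" using LB unfolding list_of_def by auto
  obtain FB L2 PB where d: "LB = FB @ L2 @ PB" "set L2 = B2" "set FB \<union> set PB = B1 - C"
    "shielded_list sp2 A2 L2"
    using shielded_list_B_decomp[OF B'(1) LB(2)] by blast
  have FP: "set FB \<inter> set PB = {}" using B'(2) d by auto
  have dX: "distinct X" using G(1) unfolding list_of_def by auto
  have FPs: "set F \<union> set P = B1 - C" using G(1) X(1) unfolding list_of_def by auto
  have core: "\<exists>Y. set Y = C \<and> distinct Y \<and> planar sp2 Y L2 \<and> shielded_list sp1 A1 (FB @ Y @ PB)"
    if p: "planar sp2 Y L2" and Y: "set Y = C" "distinct Y"
      and G: "shielded_list sp1 A1 (F' @ Y @ P')" and s: "set F' \<union> set P' = B1 - C" for Y F' P'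
  proof -
    have LBs: "shielded_list sp A (FB @ L2 @ PB)" using LB d by simp
    have LBr: "shielded_list sp A (rev PB @ rev L2 @ rev FB)"
      using shielded_list_rev[of sp A "FB @ L2 @ PB"] LBs by simp
    have Gr: "shielded_list sp1 A1 (rev P' @ rev Y @ rev F')"
      using shielded_list_rev[of sp1 A1 "F' @ Y @ P'"] G by simp
    have Ys: "shielded_list sp1 A1 Y" "shielded_list sp1 A1 (rev Y)"
      unfolding shielded_list_rev
      using shielded_list_subseq[OF G] by (simp_all add: subseq_drop_many subseq_rev_drop_many)
    have FBs: "set FB \<subseteq> B1 - C" "set PB \<subseteq> B1 - C" using d by auto
    note surround = shielded_list_surround[OF LBs FBs d(2)]
    show ?thesis
    proof (cases "unlinked sp2 A2 B2")
      case True
      have "planar sp2 (rev Y) L2"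
        using p b2.unlinked_imp_uncrossed[of "rev Y" L2] True Y d A2
        unfolding planar_def shielded_list_rev by simp
      then show ?thesis
        using tolerates_orientation[OF LBs d(2) Y(1) d(3) s FP G]
          surround[of Y] surround[of "rev Y"] Ys p Y
        by (metis distinct_rev rev_rev_ident set_rev)
    next
      case False
      have "tolerates_left Y x" if "x \<in> set FB" for x
        using tolerates_left_if_separated[OF LBs d(2) Y A2 p False G that] that d s by blast
      moreover have "tolerates_left (rev Y) x" if "x \<in> set PB" for x
        using tolerates_left_if_separated[OF LBr _ _ _ A2 _ False Gr, of x] that d s Y p
          b2.planar_rev by auto
      ultimately show ?thesis using surround[of Y] Ys Y p by blast
    qed
  qed
  have "planar sp2 X L2 \<or> planar sp2 (rev X) L2"
    using o2 d X dX A2 B'(2) unfolding orientable_def list_of_def by auto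
  then obtain Y where Y: "set Y = C" "distinct Y" "planar sp2 Y L2" "shielded_list sp1 A1 (FB @ Y @ PB)"
  proof
    assume "planar sp2 X L2"
    then show ?thesis using core[OF _ X(1) dX G(2) FPs] that by blast
  next
    assume p: "planar sp2 (rev X) L2"
    have "shielded_list sp1 A1 (rev P @ rev X @ rev F)"
      using shielded_list_rev[of sp1 A1 "F @ X @ P"] G by simp
    then show ?thesis using core[OF p, of "rev P" "rev F"] X dX FPs that by auto
  qed
  have l: "list_of (FB @ Y @ PB) B1" "list_of LA A1"
    using Y(1,2) d B'(2) C_B1 LA(1) A2 unfolding list_of_def by auto
  have "shielded_list sp1 B1 LA"
    unfolding shielded_list_def
    using shielded_restrict_A1 shielded_listD[OF LA(2)] subseq_3_in_set lA by metis
  then have "planar sp1 LA (FB @ Y @ PB) \<or> planar sp1 (rev LA) (FB @ Y @ PB)"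
    using o1 l Y unfolding orientable_def by blast
  moreover have "parts A1 sp1 B2 sp2 C L LB" if "planar sp1 L (FB @ Y @ PB)" "set L = A1" for L
    by (rule partsI[where ?L1.0 = L and FA = "[]" and PA = "[]" and X = Y and ?L2.0 = L2 and FB = FB and PB = PB])
      (use that d Y A2 in simp_all)
  ultimately show ?thesis using lA by auto
qed

text \<open>The base split keeps the foreign letters of \<open>LA\<close> at one end of
  \<open>L1\<close> and those of \<open>LB\<close> at one end of \<open>L2\<close>. Reversing lists
  reduces the four combinations to the one treated in \<open>core\<close>, where \<open>X\<close>
  can be used as it is.\<close>

lemma parts_if_both_extra:
  assumes LA: "list_of LA A" "shielded_list sp B LA" and LB: "list_of LB B" "shielded_list sp A LB"
    and G: "list_of (F @ X) B1" "shielded_list sp1 A1 (F @ X)" "F \<noteq> []"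
    and D: "list_of (X @ P) A2" "shielded_list sp2 B2 (X @ P)" "P \<noteq> []"
    and X: "set X = C"
  shows "parts A1 sp1 B2 sp2 C LA LB \<or> parts A1 sp1 B2 sp2 C (rev LA) LB"
proof -
  have core: "parts A1 sp1 B2 sp2 C LA LB"
    if lA: "LA = L1 @ PA" "shielded_list sp B LA" "set L1 = A1" "set PA = A2 - C" "shielded_list sp1 B1 L1"
      and lB: "LB = FB @ L2" "shielded_list sp A LB" "set L2 = B2" "set FB = B1 - C" "shielded_list sp2 A2 L2"
    for LA LB L1 PA FB L2
  proof -
    have s: "set F = B1 - C" "set P = A2 - C" "distinct X" using G D X unfolding list_of_def by auto
    have ne: "PA \<noteq> []" "FB \<noteq> []" using lA lB s G(3) D(3) by (metis set_empty)+
    have 1: "planar sp1 L1 (FB @ X)"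
      using planar_one_sided[OF _ _ lA(3,4) lB(4,3) X ne s(1) G(2) lA(5)] lA lB by simp
    have r: "shielded_list sp A (rev L2 @ rev FB)" "shielded_list sp B (rev PA @ rev L1)"
      "shielded_list sp2 B2 (rev P @ rev X)" "shielded_list sp2 A2 (rev L2)"
      using lA lB D(2) shielded_list_rev[of sp A LB] shielded_list_rev[of sp B LA]
        shielded_list_rev[of sp2 B2 "X @ P"] shielded_list_rev[of sp2 A2 L2] by auto
    \<comment> \<open>With the parts exchanged and all lists reversed, the configuration of
      \<open>planar_one_sided\<close> recurs.\<close>
    have "planar sp2 (rev L2) (rev PA @ rev X)"
      by (rule planar_one_sided_swap[OF r(1,2) _ _ _ _ _ _ _ _ r(3,4)])
        (use lA lB ne s X in auto)
    then have 2: "planar sp2 (X @ PA) L2"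
      using b2.planar_rev[of L2 "X @ PA"] b2.planar_commute by simp
    show ?thesis
      by (rule partsI[where ?L1.0 = L1 and FA = "[]" and PA = PA and X = X and ?L2.0 = L2 and FB = FB and PB = "[]"])
        (use 1 2 lA lB X s in simp_all)
  qed
  have B': "set LB = B" and A': "set LA = A" using LA LB unfolding list_of_def by auto
  obtain FB L2 PB where lB: "LB = FB @ L2 @ PB" "set L2 = B2" "set FB \<union> set PB = B1 - C"
    "shielded_list sp2 A2 L2"
    using shielded_list_B_decomp[OF B' LB(2)] by blast
  obtain FA L1 PA where lA: "LA = FA @ L1 @ PA" "set L1 = A1" "set FA \<union> set PA = A2 - C"
    "shielded_list sp1 B1 L1"
    using shielded_list_A_decomp[OF A' LA(2)] by blast
  have extra: "B1 - C \<noteq> {}" "A2 - C \<noteq> {}"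
    using G D X unfolding list_of_def by (auto simp: neq_Nil_conv)
  have "FA = [] \<or> PA = []"
  proof (rule ccontr)
    assume "\<not> ?thesis"
    then obtain x z where xz: "x \<in> set FA" "z \<in> set PA" using hd_in_set by blast
    obtain y where y: "y \<in> set L1" using b1.A_nonempty lA(2) by blast
    have "subseq [x, y, z] LA" using xz y by (simp add: lA(1) subseq_3_append subseq_2_append subseq_singleton_left)
    then show False
      using shieldedD[OF shielded_listD[OF LA(2)] sp_sym[OF sp_base]] xz y lA(2,3) extra(1) in_V1 in_V2
      by (metis (no_types, opaque_lifting) DiffD1 DiffD2 DiffI UnCI ex_in_conv)
  qed
  moreover have "FB = [] \<or> PB = []"
  proof (rule ccontr)
    assume "\<not> ?thesis"
    then obtain x z where xz: "x \<in> set FB" "z \<in> set PB" using hd_in_set by blast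
    obtain y where y: "y \<in> set L2" using b2.B_nonempty lB(2) by blast
    have "subseq [x, y, z] LB" using xz y by (simp add: lB(1) subseq_3_append subseq_2_append subseq_singleton_left)
    then show False
      using shieldedD[OF shielded_listD[OF LB(2)] sp_base] xz y lB(2,3) extra(2) in_V1 in_V2
      by (metis (no_types, opaque_lifting) DiffD1 DiffD2 DiffI UnCI ex_in_conv)
  qed
  moreover
  have rA: "shielded_list sp B (rev LA)" "shielded_list sp1 B1 (rev L1)"
    and rB: "shielded_list sp A (rev LB)" "shielded_list sp2 A2 (rev L2)"
    unfolding shielded_list_rev using LA LB lA lB by blast+
  ultimately consider "FA = []" "PB = []" | "PA = []" "PB = []" | "FA = []" "FB = []" | "PA = []" "FB = []"
    by blast
  then show ?thesis
  proof cases
    case 1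
    then show ?thesis using core[of LA L1 PA LB FB L2] lA lB LA LB by simp
  next
    case 2
    then have "parts A1 sp1 B2 sp2 C (rev LA) LB"
      using core[of "rev LA" "rev L1" "rev FA" LB FB L2] lA lB LB rA by simp
    then show ?thesis by blast
  next
    case 3
    then have "parts A1 sp1 B2 sp2 C LA (rev LB)"
      using core[of LA L1 PA "rev LB" "rev PB" "rev L2"] lA lB LA rB by simp
    then show ?thesis using parts_rev by fastforce
  next
    case 4
    then have "parts A1 sp1 B2 sp2 C (rev LA) (rev LB)"
      using core[of "rev LA" "rev L1" "rev FA" "rev LB" "rev PB" "rev L2"] lA lB rA rB by simp
    then show ?thesis using parts_rev by fastforce
  qed
qed

text \<open>If the first part is unlinked, its list is reversed alone. If it is linked, an extended
  split would divide \<open>A\<close> and \<open>B\<close> unless \<open>B1\<close> is the cut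
  itself and the second part is unlinked; in that case \<open>X\<close> can be reversed along with
  the list.\<close>

lemma parts_if_unlinked_no_extra:
  assumes A2: "A2 = C" and un: "unlinked sp A B"
    and LA: "list_of LA A" and LB: "list_of LB B" and p: "parts A1 sp1 B2 sp2 C (rev LA) LB"
  shows "parts A1 sp1 B2 sp2 C LA LB"
  using p LA[folded list_of_rev[of LA]] LB
proof (rule partsE)
  fix FA L1 PA FB L2 PB X
  assume *: "rev LA = FA @ L1 @ PA" "LB = FB @ L2 @ PB"
    "FA = [] \<or> FB = []" "PA = [] \<or> PB = []" "set X = C" "distinct X" "set L1 = A1" "set L2 = B2"
    "set FA \<union> set PA = A2 - C" "set FB \<union> set PB = B1 - C"
    "planar sp1 L1 (FB @ X @ PB)" "planar sp2 (FA @ X @ PA) L2"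
  have e: "FA = []" "PA = []" "L1 = rev LA" using *(1,9) A2 by auto
  have lA: "set LA = A1" using *(7) e by simp
  have lG: "set (FB @ X @ PB) = B1" using *(5,10) C_B1 by auto
  show ?thesis
  proof (cases "unlinked sp1 A1 B1")
    case True
    then have "planar sp1 LA (FB @ X @ PB)"
      using *(11) b1.unlinked_imp_uncrossed[of LA "FB @ X @ PB"] lA lG
      unfolding planar_def e shielded_list_rev by simp
    then show ?thesis
      by (rule partsI[where FA = "[]" and PA = "[]" and ?L2.0 = L2]) (use * e lA in simp_all)
  next
    case False
    have inV1: "b \<in> V1" if "b \<in> B1" for b using that in_V1 by blast
    obtain e0 where e0: "e0 \<in> B2" "e0 \<in> V2 - C" using b2.B_nonempty in_V2 by blast
    \<comment> \<open>Attaching the second part on the side of \<open>b\<close> if \<open>b\<close>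
      is a cut vertex, and anywhere otherwise, leaves a terminal of \<open>B\<close> on either side,
      so the extended split divides \<open>A\<close> and \<open>B\<close>.\<close>
    have no_extra: False
      if pq: "sp1 P Q" and m: "x \<in> P" "x \<in> A1" "y \<in> Q" "y \<in> A1" "k \<in> P" "k \<in> B1 - C" "b \<in> Q" "b \<in> B1"
      for P Q x y k b
    proof -
      have "\<exists>P' Q'. sp P' Q' \<and> x \<in> P' \<and> y \<in> Q' \<and> P' \<inter> B \<noteq> {} \<and> Q' \<inter> B \<noteq> {}"
      proof (cases "b \<in> C")
        case True
        have s: "sp (P - C) ((Q - C) \<union> (V2 - C))" using sp_sym[OF sp_ext1[OF b1.sp_sym[OF pq]]] m True by blast
        show ?thesis by (rule exI, rule exI, intro conjI, rule s) (use m e0 in_V1 in blast)+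
      next
        case False
        from pq show ?thesis
        proof (cases rule: sp_ext1_cases)
          case 1
          show ?thesis by (rule exI, rule exI, intro conjI, rule 1) (use m False in_V1 in blast)+
        next
          case 2
          show ?thesis by (rule exI, rule exI, intro conjI, rule 2) (use m False in_V1 in blast)+
        qed
      qed
      then show False using un m unfolding unlinked_def by blast
    qed
    obtain P Q x y a b where pq: "sp1 P Q" and
      m: "x \<in> P" "x \<in> A1" "y \<in> Q" "y \<in> A1" "a \<in> P" "a \<in> B1" "b \<in> Q" "b \<in> B1"
      using False unfolding unlinked_def by blast
    have "B1 = C"
    proof (rule ccontr)
      assume "B1 \<noteq> C"
      then obtain k where k: "k \<in> B1 - C" using C_B1 by blast
      then have "k \<in> P \<union> Q" using b1.sp_cover[OF pq] inV1 by blast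
      then show False
        using no_extra[OF pq m(1,2,3,4) _ k m(7,8)] no_extra[OF b1.sp_sym[OF pq] m(3,4,1,2) _ k m(5,6)]
        by blast
    qed
    then have e': "FB = []" "PB = []" and ab: "a \<in> C" "b \<in> C" using *(10) m by auto
    have un2: "unlinked sp2 A2 B2"
      unfolding unlinked_def
    proof (intro allI impI, rule ccontr)
      fix R T assume rt: "sp2 R T"
        and "\<not> (R \<inter> A2 = {} \<or> T \<inter> A2 = {} \<or> R \<inter> B2 = {} \<or> T \<inter> B2 = {})"
      then obtain c d e f where cd: "c \<in> R" "c \<in> C" "d \<in> T" "d \<in> C" "e \<in> R" "e \<in> B2" "f \<in> T" "f \<in> B2"
        using A2 by blast
      have no: False if "sp2 R T" "c \<in> P" "c \<in> R" "c \<in> C" "d \<in> Q" "d \<in> T" "d \<in> C"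
        "e \<in> R" "e \<in> B2" "f \<in> T" "f \<in> B2" for R T c d e f
      proof -
        have "x \<in> (P - C) \<union> (R - C)" "y \<in> (Q - C) \<union> (T - C)"
          "e \<in> (P - C) \<union> (R - C)" "f \<in> (Q - C) \<union> (T - C)"
          using that m in_V1 in_V2 by blast+
        then show False
          using sp_both[OF pq that(1-7)] un m(2,4) that(9,11) unfolding unlinked_def by blast
      qed
      have cover: "a \<in> R \<union> T" "b \<in> R \<union> T" "c \<in> P \<union> Q" "d \<in> P \<union> Q"
        using b1.sp_cover[OF pq] b2.sp_cover[OF rt] ab cd C_eq by blast+
      \<comment> \<open>Gluing needs a cut vertex in each of two matching pairs of sides. If
        \<open>a\<close> and \<open>b\<close> lie on the same side of \<open>R\<close>,
        \<open>T\<close>, then \<open>c\<close> or \<open>d\<close>, from the other side, replaces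
        one of them.\<close>
      note n1 = no[OF rt _ _ _ _ _ _ cd(5-8)] and n2 = no[OF b2.sp_sym[OF rt] _ _ _ _ _ _ cd(7,8,5,6)]
      consider "a \<in> R" "b \<in> R" | "a \<in> T" "b \<in> T" | "a \<in> R" "b \<in> T" | "a \<in> T" "b \<in> R"
        using cover by blast
      then show False
      proof cases
        case 1 then show False using n1[of a d] n2[of d b] m ab cd cover by blast
      next
        case 2 then show False using n1[of c b] n2[of a c] m ab cd cover by blast
      next
        case 3 then show False using n1[of a b] m ab by blast
      next
        case 4 then show False using n2[of a b] m ab by blast
      qed
    qed
    have 1: "planar sp1 LA (rev X)"
      using *(11) b1.planar_rev_left e e' by simp
    have 2: "planar sp2 (rev X) L2"
      using *(12) b2.unlinked_imp_uncrossed[of "rev X" L2] un2 *(5,8) e A2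
      unfolding planar_def by (simp add: shielded_list_rev)
    show ?thesis
      by (rule partsI[where FA = "[]" and PA = "[]" and FB = "[]" and PB = "[]" and X = "rev X"
            and ?L1.0 = LA and ?L2.0 = L2]) (use * e e' lA 1 2 in simp_all)
  qed
qed

lemma parts_swap:
  assumes "parts B2 sp2 A1 sp1 C LB LA"
  shows "parts A1 sp1 B2 sp2 C LA LB"
proof -
  obtain FA L1 PA FB L2 PB X where *: "LA = FA @ L1 @ PA" "LB = FB @ L2 @ PB"
    "FB = [] \<or> FA = []" "PB = [] \<or> PA = []" "set X = C" "distinct X" "set L1 = A1" "set L2 = B2"
    "planar sp2 L2 (FA @ X @ PA)" "planar sp1 (FB @ X @ PB) L1"
    using assms unfolding parts_def by blast
  then have "planar sp1 L1 (FB @ X @ PB)" "planar sp2 (FA @ X @ PA) L2"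
    using b1.planar_commute b2.planar_commute by metis+
  then show ?thesis by (rule partsI) (use * in auto)
qed

text \<open>When both parts contribute foreign letters, the base split itself divides
  \<open>A\<close> and \<open>B\<close>, so unlinkedness leaves only the cases in which one list is
  the bare cut.\<close>

lemma parts_if_unlinked:
  assumes un: "unlinked sp A B"
    and LA: "list_of LA A" and LB: "list_of LB B" and p: "parts A1 sp1 B2 sp2 C (rev LA) LB"
  shows "parts A1 sp1 B2 sp2 C LA LB"
proof -
  consider "A2 = C" | "B1 = C" | "A2 \<noteq> C" "B1 \<noteq> C" by blast
  then show ?thesis
  proof cases
    case 1 then show ?thesis using parts_if_unlinked_no_extra assms by blast
  next
    case 2
    have "parts B2 sp2 A1 sp1 C (rev LB) LA"
      using glued.parts_swap[OF swap parts_rev[OF p]] by simp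
    moreover have "unlinked sp B A" using un unfolding unlinked_def by blast
    ultimately show ?thesis
      using glued.parts_if_unlinked_no_extra[OF swap, unfolded sp_swap] 2 LA LB parts_swap by blast
  next
    case 3
    then obtain a b where ab: "a \<in> A2 - C" "b \<in> B1 - C" using C_A2 C_B1 by blast
    obtain a' b' where ab': "a' \<in> A1" "b' \<in> B2" using b1.A_nonempty b2.B_nonempty by blast
    have "a' \<in> V1 - C" "b \<in> V1 - C" "a \<in> V2 - C" "b' \<in> V2 - C"
      using ab ab' in_V1 in_V2 by blast+
    then show ?thesis using un sp_base ab ab' unfolding unlinked_def by blast
  qed
qed

end

section \<open>Compatible junctures\<close>

locale compatible_glued = glued +
  fixes F1 F2 X P1 P2
  assumes compat: "F1 = [] \<or> F2 = []" "P1 = [] \<or> P2 = []"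
    and distinct_all: "distinct (F1 @ F2 @ X @ P1 @ P2)"
    and G: "list_of (F1 @ X @ P1) B1" "shielded_list sp1 A1 (F1 @ X @ P1)"
    and D: "list_of (F2 @ X @ P2) A2" "shielded_list sp2 B2 (F2 @ X @ P2)"
    and o1: "orientable sp1 A1 B1" and o2: "orientable sp2 A2 B2"
begin

lemma set_X: "set X = C"
proof
  show "set X \<subseteq> C"
    using G(1) D(1) b1.B_subset b2.A_subset C_eq unfolding list_of_def by auto
  show "C \<subseteq> set X"
  proof
    fix c assume "c \<in> C"
    then have "c \<in> set (F1 @ X @ P1)" "c \<in> set (F2 @ X @ P2)"
      using C_B1 C_A2 G(1) D(1) unfolding list_of_def by auto
    then show "c \<in> set X" using distinct_all by auto
  qed
qed

text \<open>At each end at most one of the two compatible lists overhangs \<open>X\<close>, so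
  either one of them is \<open>X\<close> itself or they overhang at opposite ends.\<close>

lemma parts_up_to_rev:
  assumes LA: "list_of LA A" "shielded_list sp B LA" and LB: "list_of LB B" "shielded_list sp A LB"
  shows "parts A1 sp1 B2 sp2 C LA LB \<or> parts A1 sp1 B2 sp2 C (rev LA) LB"
proof -
  consider "F2 = []" "P2 = []" | "F1 = []" "P1 = []" | "F1 \<noteq> []" "P2 \<noteq> []" "F2 = []" "P1 = []"
    | "P1 \<noteq> []" "F2 \<noteq> []" "F1 = []" "P2 = []"
    using compat by blast
  then show ?thesis
  proof cases
    case 1
    then have "A2 = C" "shielded_list sp2 B2 X" using D set_X unfolding list_of_def by auto
    then show ?thesis using parts_if_no_extra[OF _ LA LB G set_X _ o1 o2] by blast
  next
    case 2
    then have "B1 = C" "shielded_list sp1 A1 X" using G set_X unfolding list_of_def by auto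
    then have "parts B2 sp2 A1 sp1 C LB LA \<or> parts B2 sp2 A1 sp1 C (rev LB) LA"
      using glued.parts_if_no_extra[OF swap, unfolded sp_swap] LA LB D set_X o1 o2
        b1.orientable_commute b2.orientable_commute by blast
    then show ?thesis using parts_swap parts_rev by fastforce
  next
    case 3
    then show ?thesis using parts_if_both_extra[OF LA LB, of F1 X P2] G D set_X by simp
  next
    case 4
    have "list_of (rev P1 @ rev X) B1" "shielded_list sp1 A1 (rev P1 @ rev X)"
      "list_of (rev X @ rev F2) A2" "shielded_list sp2 B2 (rev X @ rev F2)"
      using G D 4 shielded_list_rev[of sp1 A1 "X @ P1"] shielded_list_rev[of sp2 B2 "F2 @ X"]
        list_of_rev[of "X @ P1"] list_of_rev[of "F2 @ X"] by simp_all
    then show ?thesis using parts_if_both_extra[OF LA LB, of "rev P1" "rev X" "rev F2"] 4 set_X by simp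
  qed
qed

lemma orientable_glue: "orientable sp A B"
  unfolding orientable_def using parts_up_to_rev planar_if_parts list_of_rev by metis

text \<open>If only the reversed \<open>LA\<close> decomposes, then both orientations are planar, so
  \<open>A\<close> and \<open>B\<close> are unlinked and the decomposition can be turned
  around.\<close>

lemma parts_if_planar:
  assumes "list_of LA A" "list_of LB B" "planar sp LA LB"
  shows "parts A1 sp1 B2 sp2 C LA LB"
proof -
  have s: "shielded_list sp B LA" "shielded_list sp A LB" "set LA = A" "set LB = B"
    using assms unfolding planar_def list_of_def by auto
  from parts_up_to_rev[OF assms(1) s(1) assms(2) s(2)] show ?thesis
  proof
    assume p: "parts A1 sp1 B2 sp2 C (rev LA) LB"
    then have "planar sp (rev LA) LB" using planar_if_parts assms list_of_rev by metis
    then have "unlinked sp A B" using planar_both_imp_unlinked assms(3) s by metis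
    then show ?thesis using parts_if_unlinked assms p by blast
  qed
qed

text \<open>The given lists are first oriented against the two compatible lists, which then supply
  the overhanging letters and the common \<open>X\<close>.\<close>

lemma planar_glue_exists:
  assumes "list_of L1 A1" "shielded_list sp1 B1 L1" "list_of L2 B2" "shielded_list sp2 A2 L2"
  obtains LA LB where "list_of LA A" "list_of LB B" "planar sp LA LB"
proof -
  obtain L1' where L1': "list_of L1' A1" "planar sp1 L1' (F1 @ X @ P1)"
    using o1 assms(1,2) G list_of_rev unfolding orientable_def by metis
  obtain L2' where L2': "list_of L2' B2" "planar sp2 (F2 @ X @ P2) L2'"
  proof -
    have "planar sp2 (F2 @ X @ P2) L2 \<or> planar sp2 (F2 @ X @ P2) (rev L2)"
      using o2 assms(3,4) D b2.planar_rev_left unfolding orientable_def by metis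
    then show ?thesis using that assms(3) list_of_rev by metis
  qed
  have disj: "A1 \<inter> (A2 - C) = {}" "B2 \<inter> (B1 - C) = {}"
    using C_eq b1.A_subset b2.A_subset b1.B_subset b2.B_subset by blast+
  have s: "set F2 \<union> set P2 = A2 - C" "set F1 \<union> set P1 = B1 - C" "set L1' = A1" "set L2' = B2"
    using G(1) D(1) L1' L2' set_X unfolding list_of_def by auto
  have "parts A1 sp1 B2 sp2 C (F2 @ L1' @ P2) (F1 @ L2' @ P1)"
    by (rule partsI[OF L1'(2) L2'(2)]) (use compat set_X s distinct_all in auto)
  moreover have "list_of (F2 @ L1' @ P2) A" "list_of (F1 @ L2' @ P1) B"
    using distinct_all L1'(1) L2'(1) s disj unfolding list_of_def by auto
  ultimately show ?thesis using that planar_if_parts by blast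
qed

end

section \<open>Connected vertex sets\<close>

text \<open>Connectedness through cuts instead of paths avoids surgery on semipaths when parts are
  glued. The empty set counts as connected, as removing the cut may empty a side.\<close>

definition connected_set :: "('v \<Rightarrow> 'v \<Rightarrow> bool) \<Rightarrow> 'v set \<Rightarrow> bool" where
  "connected_set r S \<longleftrightarrow> (\<forall>K \<subseteq> S. K \<noteq> {} \<longrightarrow> K \<noteq> S \<longrightarrow> (\<exists>x \<in> K. \<exists>y \<in> S - K. r x y))"

lemma connected_setD:
  assumes "connected_set r S" "K \<subseteq> S" "x \<in> K" "y \<in> S - K"
  obtains k s where "k \<in> K" "s \<in> S - K" "r k s"
  using assms unfolding connected_set_def by (metis DiffE empty_iff)

lemma connected_set_mono:
  assumes "connected_set r S" "\<And>x y. x \<in> S \<Longrightarrow> y \<in> S \<Longrightarrow> r x y \<Longrightarrow> r' x y"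
  shows "connected_set r' S"
  using assms unfolding connected_set_def by (meson DiffD1 subsetD)

lemma connected_set_Un:
  assumes S: "connected_set r S" and T: "connected_set r T" and yz: "y \<in> S" "z \<in> T" "r y z"
    and sym: "\<And>x y. r x y \<Longrightarrow> r y x"
  shows "connected_set r (S \<union> T)"
  unfolding connected_set_def
proof (intro allI impI)
  fix K assume K: "K \<subseteq> S \<union> T" "K \<noteq> {}" "K \<noteq> S \<union> T"
  show "\<exists>x\<in>K. \<exists>y\<in>S \<union> T - K. r x y"
  proof (cases "(\<exists>a\<in>S \<inter> K. \<exists>b\<in>S - K. True) \<or> (\<exists>a\<in>T \<inter> K. \<exists>b\<in>T - K. True)")
    case True
    then consider a b where "a \<in> S \<inter> K" "b \<in> S - S \<inter> K" | a b where "a \<in> T \<inter> K" "b \<in> T - T \<inter> K"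
      by blast
    then show ?thesis
    proof cases
      case 1 then show ?thesis using connected_setD[OF S, of "S \<inter> K" a b] by blast
    next
      case 2 then show ?thesis using connected_setD[OF T, of "T \<inter> K" a b] by blast
    qed
  next
    case False
    then have "y \<in> K \<longleftrightarrow> z \<notin> K" using K yz by blast
    then show ?thesis using yz sym by blast
  qed
qed

lemma connected_set_remove_leaves:
  assumes P: "connected_set r P" and sym: "\<And>x y. r x y \<Longrightarrow> r y x"
    and leaf: "\<And>c x y. c \<in> C \<Longrightarrow> r c x \<Longrightarrow> r c y \<Longrightarrow> x = y"
    and off: "\<And>c x. c \<in> C \<Longrightarrow> r c x \<Longrightarrow> x \<notin> C"
  shows "connected_set r (P - C)"
  unfolding connected_set_def
proof (intro allI impI)
  fix K assume K: "K \<subseteq> P - C" "K \<noteq> {}" "K \<noteq> P - C"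
  \<comment> \<open>Leaves attached to \<open>K\<close> are added to it; an edge leaving the
    enlarged set then has both ends off \<open>C\<close>.\<close>
  let ?K = "K \<union> {c \<in> P \<inter> C. \<exists>y\<in>K. r c y}"
  obtain a b where ab: "a \<in> ?K" "b \<in> P - ?K" using K by blast
  obtain x y where xy: "x \<in> ?K" "y \<in> P - ?K" "r x y"
    by (rule connected_setD[OF P _ ab]) (use K in auto)
  have "x \<notin> C" using xy K leaf off by blast
  then have "x \<in> K" using xy by blast
  moreover have "y \<notin> C" using xy \<open>x \<in> K\<close> sym by blast
  ultimately show "\<exists>x\<in>K. \<exists>y\<in>P - C - K. r x y" using xy by blast
qed

section \<open>Semipaths and connected sets\<close>

definition adjacent :: "('v, 'e) pre_digraph \<Rightarrow> 'v \<Rightarrow> 'v \<Rightarrow> bool" where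
  "adjacent D x y \<longleftrightarrow> (\<exists>a \<in> arcs D. {tail D a, head D a} = {x, y})"

lemma adjacent_sym: "adjacent D x y \<Longrightarrow> adjacent D y x"
  unfolding adjacent_def by (metis insert_commute)

lemma adjacentE:
  assumes "adjacent D x y"
  obtains a where "a \<in> arcs D" "tail D a = x" "head D a = y"
    | a where "a \<in> arcs D" "tail D a = y" "head D a = x"
  using assms unfolding adjacent_def doubleton_eq_iff by blast

lemma adjacentI: "a \<in> arcs D \<Longrightarrow> adjacent D (tail D a) (head D a)"
  unfolding adjacent_def by blast

lemma semipath_extend:
  assumes "semipath D (vs, as)" "last vs = k" "a \<in> arcs D" "{tail D a, head D a} = {k, z}"
    "z \<notin> set vs" "z \<in> verts D"
  shows "semipath D (vs @ [z], as @ [a])"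
proof -
  have l: "length vs = Suc (length as)" and i: "\<forall>i < length as. {tail D (as ! i), head D (as ! i)} = {vs ! i, vs ! Suc i}"
    using assms(1) unfolding semipath_def by auto
  have "vs ! length as = k" using assms(2) l by (metis diff_Suc_1 last_conv_nth length_0_conv nat.distinct(1))
  then show ?thesis
    using assms l i unfolding semipath_def by (auto simp: nth_append less_Suc_eq)
qed

lemma semipath_prefix:
  assumes "semipath D (us @ z # ws, as)"
  shows "semipath D (us @ [z], take (length us) as)"
proof -
  have l: "length (us @ z # ws) = Suc (length as)"
    and i: "\<forall>i < length as. {tail D (as ! i), head D (as ! i)} = {(us @ z # ws) ! i, (us @ z # ws) ! Suc i}"
    and o: "distinct (us @ z # ws)" "set (us @ z # ws) \<subseteq> verts D" "set as \<subseteq> arcs D"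
    using assms unfolding semipath_def by auto
  have "(us @ [z]) ! i = (us @ z # ws) ! i" if "i \<le> length us" for i
    using that by (auto simp: nth_append nth_Cons' split: if_splits)
  then show ?thesis
    using l i o set_take_subset[of "length us" as] unfolding semipath_def by auto
qed

lemma connected_set_semipath:
  assumes S: "connected_set (adjacent D) S" "S \<subseteq> verts D" and xy: "x \<in> S" "y \<in> S"
  obtains p where "p \<in> semipaths D x y" "set (fst p) \<subseteq> S"
proof -
  let ?K = "{z \<in> S. \<exists>p \<in> semipaths D x z. set (fst p) \<subseteq> S}"
  have "([x], []) \<in> semipaths D x x" unfolding semipaths_def semipath_def using S xy by auto
  then have x: "x \<in> ?K" using xy by force
  have "y \<in> ?K"
  proof (rule ccontr)
    assume "y \<notin> ?K"
    then obtain k z where kz: "k \<in> ?K" "z \<in> S - ?K" "adjacent D k z"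
      using connected_setD[OF S(1) _ x, of y] xy by blast
    then obtain vs as where p: "semipath D (vs, as)" "hd vs = x" "last vs = k" "set vs \<subseteq> S"
      unfolding semipaths_def by fastforce
    have ne: "vs \<noteq> []" using p(1) unfolding semipath_def by auto
    have "\<exists>q \<in> semipaths D x z. set (fst q) \<subseteq> S"
    proof (cases "z \<in> set vs")
      \<comment> \<open>Semipaths do not repeat vertices, so one that already visits
        \<open>z\<close> is cut off there.\<close>
      case True
      then obtain us ws where vs: "vs = us @ z # ws" by (meson split_list)
      have "(us @ [z], take (length us) as) \<in> semipaths D x z"
        using semipath_prefix[of D us z ws as] p vs unfolding semipaths_def
        by (cases us) auto
      then show ?thesis using p(4) vs by force
    next
      case False
      obtain a where "a \<in> arcs D" "{tail D a, head D a} = {k, z}"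
        using kz(3) unfolding adjacent_def by blast
      then have "semipath D (vs @ [z], as @ [a])"
        using semipath_extend[OF p(1,3)] False kz S(2) by blast
      then have "(vs @ [z], as @ [a]) \<in> semipaths D x z"
        using p(2) ne unfolding semipaths_def by simp
      then show ?thesis using p(4) kz by force
    qed
    then show False using kz by blast
  qed
  then show ?thesis using that by blast
qed

lemma weakly_connected_iff: "weakly_connected D \<longleftrightarrow> connected_set (adjacent D) (verts D)"
proof
  assume "connected_set (adjacent D) (verts D)"
  then show "weakly_connected D"
    unfolding weakly_connected_def using connected_set_semipath[of D "verts D"] by (metis empty_iff order_refl)
next
  assume w: "weakly_connected D"
  show "connected_set (adjacent D) (verts D)"
    unfolding connected_set_def
  proof (intro allI impI)
    fix K assume K: "K \<subseteq> verts D" "K \<noteq> {}" "K \<noteq> verts D"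
    then obtain x y where xy: "x \<in> K" "y \<in> verts D - K" by blast
    then have "x \<in> verts D" "y \<in> verts D" "x \<noteq> y" using K by auto
    then have "semipaths D x y \<noteq> {}" using w unfolding weakly_connected_def by simp
    then obtain vs as where p: "semipath D (vs, as)" "hd vs = x" "last vs = y"
      unfolding semipaths_def by auto
    have l: "length vs = Suc (length as)" and i: "\<forall>i < length as. {tail D (as ! i), head D (as ! i)} = {vs ! i, vs ! Suc i}"
      and s: "set vs \<subseteq> verts D" "set as \<subseteq> arcs D"
      using p(1) unfolding semipath_def by auto
    have 0: "vs ! 0 \<in> K" and n: "vs ! length as \<notin> K"
      using p(2,3) xy l by (metis hd_conv_nth length_0_conv nat.distinct(1),
          metis DiffD2 diff_Suc_1 last_conv_nth length_0_conv nat.distinct(1))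
    have "\<exists>i < length as. vs ! i \<in> K \<and> vs ! Suc i \<notin> K"
    proof (rule ccontr)
      assume c: "\<not> ?thesis"
      have "i \<le> length as \<Longrightarrow> vs ! i \<in> K" for i
        by (induction i) (use 0 c in auto)
      then show False using n by blast
    qed
    then obtain j where j: "j < length as" "vs ! j \<in> K" "vs ! Suc j \<notin> K" by blast
    have "adjacent D (vs ! j) (vs ! Suc j)" "vs ! Suc j \<in> verts D"
      using j i s l unfolding adjacent_def by (meson nth_mem subsetD, metis Suc_less_eq nth_mem subsetD)
    then show "\<exists>x\<in>K. \<exists>y\<in>verts D - K. adjacent D x y" using j by blast
  qed
qed

section \<open>The juncture of two D-graphs\<close>

lemma W_verts_iff: "v \<in> X_verts W D \<longleftrightarrow> v \<in> verts D \<and> (\<forall>a \<in> arcs D. head D a \<noteq> v)"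
  unfolding X_verts_def by auto

lemma E_verts_iff: "v \<in> X_verts E D \<longleftrightarrow> v \<in> verts D \<and> (\<forall>a \<in> arcs D. tail D a \<noteq> v)"
  unfolding X_verts_def by auto

lemma X_verts_in_verts: "v \<in> X_verts X D \<Longrightarrow> v \<in> verts D"
  unfolding X_verts_def by blast

lemma WE_functional_iff:
  "WE_functional D \<longleftrightarrow>
     (\<forall>a \<in> arcs D. \<forall>b \<in> arcs D. tail D a \<in> X_verts W D \<longrightarrow> tail D a = tail D b \<longrightarrow> a = b) \<and>
     (\<forall>a \<in> arcs D. \<forall>b \<in> arcs D. head D a \<in> X_verts E D \<longrightarrow> head D a = head D b \<longrightarrow> a = b)"
  (is "?l \<longleftrightarrow> ?W \<and> ?E")
proof -
  have all: "(\<forall>X. Q X) \<longleftrightarrow> Q W \<and> Q E" for Q by (metis side.exhaust)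
  show ?thesis unfolding WE_functional_def all X_arcs_def by auto
qed

text \<open>A vertex in both sets would be isolated, although it has to be joined to an inner
  vertex.\<close>

lemma X_verts_disjoint:
  assumes "D_graph D" shows "X_verts W D \<inter> X_verts E D = {}"
proof (rule ccontr)
  assume "\<not> ?thesis"
  then obtain v where v: "v \<in> X_verts W D" "v \<in> X_verts E D" by blast
  obtain u where u: "u \<in> inner_verts D" using assms unfolding D_graph_def by blast
  then have "u \<in> verts D - {v}" using v unfolding inner_verts_def by auto
  moreover have "connected_set (adjacent D) (verts D)" "v \<in> verts D"
    using assms v unfolding D_graph_def weakly_connected_iff W_verts_iff by auto
  ultimately obtain y where "adjacent D v y"
    using connected_setD[of "adjacent D" "verts D" "{v}" v u] by auto
  then show False using v unfolding W_verts_iff E_verts_iff by (metis adjacentE)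
qed

text \<open>The inner vertex has an incoming and an outgoing edge. Their other ends differ from it,
  since a loop is a cycle, and so they are not inner.\<close>

lemma basic_X_verts_nonempty:
  assumes "basic_D_graph D" shows "X_verts W D \<noteq> {}" "X_verts E D \<noteq> {}"
proof -
  have D: "D_graph D" using assms unfolding basic_D_graph_def by blast
  then have wf: "wf_digraph D" unfolding D_graph_def fin_digraph_def by blast
  obtain v where v: "v \<in> inner_verts D" "\<And>u. u \<in> inner_verts D \<Longrightarrow> u = v"
    using assms unfolding basic_D_graph_def by blast
  have loop: "tail D a \<noteq> head D a" if "a \<in> arcs D" for a
  proof
    assume "tail D a = head D a"
    then have "pre_digraph.cycle D [a]"
      unfolding pre_digraph.cycle_def pre_digraph.awalk_def
      using that wf_digraph.head_in_verts[OF wf that]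
      by (auto simp: pre_digraph.cas.simps pre_digraph.awalk_verts.simps)
    then show False using D unfolding D_graph_def by blast
  qed
  obtain a b where ab: "a \<in> arcs D" "head D a = v" "b \<in> arcs D" "tail D b = v"
    using v(1) unfolding inner_verts_def by (auto simp: W_verts_iff E_verts_iff)
  have "tail D a \<in> X_verts W D"
    using v(2)[of "tail D a"] loop[OF ab(1)] ab(1,2) wf_digraph.tail_in_verts[OF wf ab(1)]
    unfolding inner_verts_def by (auto simp: E_verts_iff)
  moreover have "head D b \<in> X_verts E D"
    using v(2)[of "head D b"] loop[OF ab(3)] ab(3,4) wf_digraph.head_in_verts[OF wf ab(3)]
    unfolding inner_verts_def by (auto simp: W_verts_iff)
  ultimately show "X_verts W D \<noteq> {}" "X_verts E D \<noteq> {}" by blast+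
qed

locale defined_juncture =
  fixes DW DE :: "('v, 'e) pre_digraph"
  assumes defined: "juncture_defined DW DE"
begin

abbreviation "D \<equiv> juncture DW DE"
abbreviation "C \<equiv> cut_verts DW DE"

lemma D_graphs: "D_graph DW" "D_graph DE"
  using defined unfolding juncture_defined_def by auto

sublocale W: fin_digraph DW using D_graphs(1) unfolding D_graph_def by blast
sublocale E: fin_digraph DE using D_graphs(2) unfolding D_graph_def by blast

lemma C_eq: "C = verts DW \<inter> verts DE" and C_nonempty: "C \<noteq> {}"
  using defined unfolding juncture_defined_def cut_verts_def by auto

lemma cut_arc:
  assumes "a \<in> arcs DW" "a \<in> arcs DE"
  shows "head DW a = tail DE a" "head DW a \<in> C" "head DW a \<in> X_verts E DW" "head DW a \<in> X_verts W DE"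
proof -
  have a: "a \<in> cut_arcs DW DE" using assms unfolding cut_arcs_def by blast
  then have *: "head DW a = tail DE a \<and> a \<in> X_arcs E DW \<and> a \<in> X_arcs W DE"
    using defined unfolding juncture_defined_def by blast
  then show "head DW a = tail DE a" "head DW a \<in> X_verts E DW" "head DW a \<in> X_verts W DE"
    unfolding X_arcs_def by auto
  show "head DW a \<in> C" using a unfolding cut_verts_def by blast
qed

lemma cut_vertE:
  assumes "c \<in> C"
  obtains a where "a \<in> arcs DW" "a \<in> arcs DE" "head DW a = c" "tail DE a = c"
  using assms cut_arc(1) unfolding cut_verts_def cut_arcs_def by auto

lemma C_E_verts: "C \<subseteq> X_verts E DW" and C_W_verts: "C \<subseteq> X_verts W DE"
  by (auto elim!: cut_vertE dest: cut_arc(3,4))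

lemma tail_notin_C: "a \<in> arcs DW \<Longrightarrow> tail DW a \<notin> C"
  using subsetD[OF C_E_verts, of "tail DW a"] by (auto simp: E_verts_iff)

lemma head_notin_C: "a \<in> arcs DE \<Longrightarrow> head DE a \<notin> C"
  using subsetD[OF C_W_verts, of "head DE a"] by (auto simp: W_verts_iff)

lemma functional:
  "a \<in> arcs DW \<Longrightarrow> b \<in> arcs DW \<Longrightarrow> tail DW a \<in> X_verts W DW \<Longrightarrow> tail DW a = tail DW b \<Longrightarrow> a = b"
  "a \<in> arcs DW \<Longrightarrow> b \<in> arcs DW \<Longrightarrow> head DW a \<in> X_verts E DW \<Longrightarrow> head DW a = head DW b \<Longrightarrow> a = b"
  "a \<in> arcs DE \<Longrightarrow> b \<in> arcs DE \<Longrightarrow> tail DE a \<in> X_verts W DE \<Longrightarrow> tail DE a = tail DE b \<Longrightarrow> a = b"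
  "a \<in> arcs DE \<Longrightarrow> b \<in> arcs DE \<Longrightarrow> head DE a \<in> X_verts E DE \<Longrightarrow> head DE a = head DE b \<Longrightarrow> a = b"
  using D_graphs unfolding D_graph_def WE_functional_iff by blast+

text \<open>A cut vertex is an E-vertex of \<open>DW\<close>, so by functionality only one edge of
  \<open>DW\<close> ends there, and this is a cut edge.\<close>

lemma head_in_C_iff: "a \<in> arcs DW \<Longrightarrow> head DW a \<in> C \<longleftrightarrow> a \<in> arcs DE"
  using cut_arc cut_vertE functional(2) C_E_verts by (metis subsetD)

lemma tail_in_C_iff: "a \<in> arcs DE \<Longrightarrow> tail DE a \<in> C \<longleftrightarrow> a \<in> arcs DW"
  using cut_arc cut_vertE functional(3) C_W_verts by (metis subsetD)

lemma juncture_simps: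
  "verts D = (verts DW \<union> verts DE) - C" "arcs D = arcs DW \<union> arcs DE"
  "a \<in> arcs DW \<Longrightarrow> tail D a = tail DW a" "a \<notin> arcs DW \<Longrightarrow> tail D a = tail DE a"
  "a \<in> arcs DE \<Longrightarrow> head D a = head DE a" "a \<notin> arcs DE \<Longrightarrow> head D a = head DW a"
  unfolding juncture_def by simp_all

lemma tail_cases:
  assumes "a \<in> arcs D"
  obtains "a \<in> arcs DW" "tail D a = tail DW a" "tail D a \<in> verts DW" "tail D a \<notin> verts DE"
  | "a \<in> arcs DE" "a \<notin> arcs DW" "tail D a = tail DE a" "tail D a \<in> verts DE" "tail D a \<notin> verts DW"
proof (cases "a \<in> arcs DW")
  case True
  then show ?thesis using that(1) tail_notin_C C_eq juncture_simps W.tail_in_verts by auto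
next
  case False
  then have "a \<in> arcs DE" using assms juncture_simps by auto
  then show ?thesis using that(2) False tail_in_C_iff C_eq juncture_simps E.tail_in_verts by auto
qed

lemma head_cases:
  assumes "a \<in> arcs D"
  obtains "a \<in> arcs DE" "head D a = head DE a" "head D a \<in> verts DE" "head D a \<notin> verts DW"
  | "a \<in> arcs DW" "a \<notin> arcs DE" "head D a = head DW a" "head D a \<in> verts DW" "head D a \<notin> verts DE"
proof (cases "a \<in> arcs DE")
  case True
  then show ?thesis using that(1) head_notin_C C_eq juncture_simps E.head_in_verts by auto
next
  case False
  then have "a \<in> arcs DW" using assms juncture_simps by auto
  then show ?thesis using that(2) False head_in_C_iff C_eq juncture_simps W.head_in_verts by auto
qed

lemma W_verts_juncture: "X_verts W D = X_verts W DW \<union> (X_verts W DE - C)"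
proof (intro equalityI subsetI)
  fix v assume "v \<in> X_verts W D"
  then have v: "v \<in> verts DW \<union> verts DE" "v \<notin> C" "\<And>a. a \<in> arcs DW \<union> arcs DE \<Longrightarrow> head D a \<noteq> v"
    unfolding W_verts_iff juncture_simps by auto
  have "head DW a \<noteq> v" if "a \<in> arcs DW" for a
    using v(2) v(3)[of a] that head_in_C_iff[OF that] juncture_simps(6) by auto
  moreover have "head DE a \<noteq> v" if "a \<in> arcs DE" for a
    using v(3)[of a] that juncture_simps(5) by auto
  ultimately show "v \<in> X_verts W DW \<union> (X_verts W DE - C)"
    using v(1,2) by (auto simp: W_verts_iff)
next
  fix v assume "v \<in> X_verts W DW \<union> (X_verts W DE - C)"
  then consider "v \<in> X_verts W DW" | "v \<in> X_verts W DE" "v \<notin> C" by blast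
  then show "v \<in> X_verts W D"
  proof cases
    case 1
    then have "v \<notin> C" unfolding W_verts_iff by (metis cut_vertE)
    moreover have "head D a \<noteq> v" if "a \<in> arcs D" for a
      using that by (rule head_cases) (use 1 in \<open>auto simp: W_verts_iff\<close>)
    ultimately show ?thesis using 1 unfolding W_verts_iff juncture_simps(1) by blast
  next
    case 2
    have "head D a \<noteq> v" if "a \<in> arcs D" for a
      using that by (rule head_cases) (use 2 in \<open>auto simp: W_verts_iff\<close>)
    then show ?thesis using 2 unfolding W_verts_iff juncture_simps(1) by blast
  qed
qed

lemma E_verts_juncture: "X_verts E D = X_verts E DE \<union> (X_verts E DW - C)"
proof (intro equalityI subsetI)
  fix v assume "v \<in> X_verts E D"
  then have v: "v \<in> verts DW \<union> verts DE" "v \<notin> C" "\<And>a. a \<in> arcs DW \<union> arcs DE \<Longrightarrow> tail D a \<noteq> v"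
    unfolding E_verts_iff juncture_simps by auto
  have "tail DE a \<noteq> v" if "a \<in> arcs DE" for a
    using v(2) v(3)[of a] that tail_in_C_iff[OF that] juncture_simps(4) by auto
  moreover have "tail DW a \<noteq> v" if "a \<in> arcs DW" for a
    using v(3)[of a] that juncture_simps(3) by auto
  ultimately show "v \<in> X_verts E DE \<union> (X_verts E DW - C)"
    using v(1,2) by (auto simp: E_verts_iff)
next
  fix v assume "v \<in> X_verts E DE \<union> (X_verts E DW - C)"
  then consider "v \<in> X_verts E DE" | "v \<in> X_verts E DW" "v \<notin> C" by blast
  then show "v \<in> X_verts E D"
  proof cases
    case 1
    then have "v \<notin> C" unfolding E_verts_iff by (metis cut_vertE)
    moreover have "tail D a \<noteq> v" if "a \<in> arcs D" for a
      using that by (rule tail_cases) (use 1 in \<open>auto simp: E_verts_iff\<close>)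
    ultimately show ?thesis using 1 unfolding E_verts_iff juncture_simps(1) by blast
  next
    case 2
    have "tail D a \<noteq> v" if "a \<in> arcs D" for a
      using that by (rule tail_cases) (use 2 in \<open>auto simp: E_verts_iff\<close>)
    then show ?thesis using 2 unfolding E_verts_iff juncture_simps(1) by blast
  qed
qed

lemma cut_vert_neighbour_W:
  assumes "c \<in> C" "adjacent DW c x"
  obtains a where "a \<in> arcs DW" "head DW a = c" "tail DW a = x" "x \<notin> C"
  using assms(2)
proof (cases rule: adjacentE)
  case (1 a) then show ?thesis using that[of a] assms(1) tail_notin_C[of a] by auto
next
  case (2 a) then show ?thesis using that[of a] assms(1) tail_notin_C[of a] by auto
qed

text \<open>Cut vertices are leaves of \<open>DW\<close>, and the edges of \<open>DW\<close> between
  other vertices keep their ends in the juncture.\<close>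

lemma connected_set_diff_W:
  assumes "connected_set (adjacent DW) P"
  shows "connected_set (adjacent D) (P - C)"
proof -
  have "connected_set (adjacent DW) (P - C)"
    using assms
  proof (rule connected_set_remove_leaves)
    fix c x y assume "c \<in> C" "adjacent DW c x" "adjacent DW c y"
    then show "x = y"
      using cut_vert_neighbour_W functional(2) subsetD[OF C_E_verts] by metis
  next
    fix c x assume "c \<in> C" "adjacent DW c x"
    then show "x \<notin> C" using cut_vert_neighbour_W by metis
  qed (rule adjacent_sym)
  then show ?thesis
  proof (rule connected_set_mono)
    fix x y assume xy: "x \<in> P - C" "y \<in> P - C" and "adjacent DW x y"
    then obtain a where a: "a \<in> arcs DW" "{tail DW a, head DW a} = {x, y}"
      unfolding adjacent_def by blast
    then have "a \<notin> arcs DE" using xy head_in_C_iff[OF a(1)] by auto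
    then show "adjacent D x y"
      unfolding adjacent_def using a by (intro bexI[of _ a]) (simp_all add: juncture_simps)
  qed
qed

lemma cut_vert_neighbour_E:
  assumes "c \<in> C" "adjacent DE c x"
  obtains a where "a \<in> arcs DE" "tail DE a = c" "head DE a = x" "x \<notin> C"
  using assms(2)
proof (cases rule: adjacentE)
  case (1 a) then show ?thesis using that[of a] assms(1) head_notin_C[of a] by auto
next
  case (2 a) then show ?thesis using that[of a] assms(1) head_notin_C[of a] by auto
qed

lemma connected_set_diff_E:
  assumes "connected_set (adjacent DE) P"
  shows "connected_set (adjacent D) (P - C)"
proof -
  have "connected_set (adjacent DE) (P - C)"
    using assms
  proof (rule connected_set_remove_leaves)
    fix c x y assume "c \<in> C" "adjacent DE c x" "adjacent DE c y"
    then show "x = y"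
      using cut_vert_neighbour_E functional(3) subsetD[OF C_W_verts] by metis
  next
    fix c x assume "c \<in> C" "adjacent DE c x"
    then show "x \<notin> C" using cut_vert_neighbour_E by metis
  qed (rule adjacent_sym)
  then show ?thesis
  proof (rule connected_set_mono)
    fix x y assume xy: "x \<in> P - C" "y \<in> P - C" and "adjacent DE x y"
    then obtain a where a: "a \<in> arcs DE" "{tail DE a, head DE a} = {x, y}"
      unfolding adjacent_def by blast
    then have "a \<notin> arcs DW" using xy tail_in_C_iff[OF a(1)] by auto
    then show "adjacent D x y"
      unfolding adjacent_def using a by (intro bexI[of _ a]) (simp_all add: juncture_simps)
  qed
qed

text \<open>The only edge of \<open>DW\<close> at \<open>c\<close> and the only edge of
  \<open>DE\<close> at \<open>c\<close> are the same cut edge, which in the juncture joins the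
  neighbours of \<open>c\<close> directly.\<close>

lemma connected_set_glue:
  assumes P: "connected_set (adjacent DW) P" and R: "connected_set (adjacent DE) R"
    and c: "c \<in> P" "c \<in> R" "c \<in> C"
  shows "connected_set (adjacent D) ((P - C) \<union> (R - C))"
proof (cases "P - C = {} \<or> R - C = {}")
  case True
  then show ?thesis using connected_set_diff_W[OF P] connected_set_diff_E[OF R]
    by (metis Un_empty_left Un_empty_right)
next
  case False
  then obtain p r where pr: "p \<in> P - {c}" "r \<in> R - {c}" using c by blast
  obtain y where y: "y \<in> P" "adjacent DW c y"
    using connected_setD[OF P, of "{c}" c p] pr c by blast
  obtain z where z: "z \<in> R" "adjacent DE c z"
    using connected_setD[OF R, of "{c}" c r] pr c by blast
  obtain a where a: "a \<in> arcs DW" "tail DW a = y" "head DW a = c"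
    using cut_vert_neighbour_W[OF c(3) y(2)] by metis
  obtain b where b: "b \<in> arcs DE" "tail DE b = c" "head DE b = z"
    using cut_vert_neighbour_E[OF c(3) z(2)] by metis
  have aE: "a \<in> arcs DE" using head_in_C_iff a c by blast
  then have "tail DE a = c" using cut_arc(1) a by auto
  then have "a = b" using functional(3)[OF aE b(1)] subsetD[OF C_W_verts c(3)] b by simp
  then have "adjacent D y z"
    using adjacentI[of a D] juncture_simps a b by auto
  moreover have "y \<in> P - C" "z \<in> R - C"
    using y z a b tail_notin_C head_notin_C by auto
  ultimately show ?thesis
    using connected_set_Un[OF connected_set_diff_W[OF P] connected_set_diff_E[OF R]] adjacent_sym by metis
qed

lemma connected_verts: "connected_set (adjacent DW) (verts DW)" "connected_set (adjacent DE) (verts DE)"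
  using D_graphs unfolding D_graph_def weakly_connected_iff by auto

section \<open>Junctures are D-graphs\<close>

lemma fin_digraph_juncture: "fin_digraph D"
proof
  show "finite (verts D)" "finite (arcs D)"
    unfolding juncture_simps by auto
  fix a assume a: "a \<in> arcs D"
  show "tail D a \<in> verts D"
    using a by (rule tail_cases) (auto simp: juncture_simps(1) C_eq)
  show "head D a \<in> verts D"
    using a by (rule head_cases) (auto simp: juncture_simps(1) C_eq)
qed

lemma WE_functional_juncture: "WE_functional D"
  unfolding WE_functional_iff
proof (intro conjI ballI impI)
  fix a b assume a: "a \<in> arcs D" and b: "b \<in> arcs D"
    and x: "tail D a \<in> X_verts W D" and eq: "tail D a = tail D b"
  note sets = x[unfolded W_verts_juncture]
  from a show "a = b"
  proof (cases rule: tail_cases)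
    case 1
    then have "b \<in> arcs DW" "tail DW b = tail DW a"
      using tail_cases[OF b] eq by metis+
    moreover have "tail DW a \<in> X_verts W DW" using sets 1 by (auto dest: X_verts_in_verts)
    ultimately show ?thesis using functional(1) 1 by metis
  next
    case 2
    then have "b \<in> arcs DE" "tail DE b = tail DE a"
      using tail_cases[OF b] eq by metis+
    moreover have "tail DE a \<in> X_verts W DE" using sets 2 by (auto dest: X_verts_in_verts)
    ultimately show ?thesis using functional(3) 2 by metis
  qed
next
  fix a b assume a: "a \<in> arcs D" and b: "b \<in> arcs D"
    and x: "head D a \<in> X_verts E D" and eq: "head D a = head D b"
  note sets = x[unfolded E_verts_juncture]
  from a show "a = b"
  proof (cases rule: head_cases)
    case 1
    then have "b \<in> arcs DE" "head DE b = head DE a"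
      using head_cases[OF b] eq by metis+
    moreover have "head DE a \<in> X_verts E DE" using sets 1 by (auto dest: X_verts_in_verts)
    ultimately show ?thesis using functional(4) 1 by metis
  next
    case 2
    then have "b \<in> arcs DW" "head DW b = head DW a"
      using head_cases[OF b] eq by metis+
    moreover have "head DW a \<in> X_verts E DW" using sets 2 by (auto dest: X_verts_in_verts)
    ultimately show ?thesis using functional(2) 2 by metis
  qed
qed

text \<open>No arc of the juncture leads from \<open>verts DE\<close> back to \<open>verts DW\<close>.\<close>

lemma walk_from_E:
  assumes "pre_digraph.cas D u p v" "set p \<subseteq> arcs D" "u \<in> verts DE" "u \<notin> verts DW"
  shows "v \<in> verts DE \<and> v \<notin> verts DW \<and> set p \<subseteq> arcs DE \<and> pre_digraph.cas DE u p v \<and>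
    pre_digraph.awalk_verts DE u p = pre_digraph.awalk_verts D u p"
  using assms
proof (induction p arbitrary: u)
  case Nil then show ?case by (simp add: pre_digraph.cas.simps pre_digraph.awalk_verts.simps)
next
  case (Cons a p)
  then have t: "tail D a = u" "a \<in> arcs D" and c: "pre_digraph.cas D (head D a) p v"
    by (auto simp: pre_digraph.cas.simps)
  have a: "a \<in> arcs DE" "tail DE a = u" using t Cons.prems tail_cases[OF t(2)] by metis+
  have h: "head D a = head DE a" using a juncture_simps by blast
  have "head D a \<in> verts DE" "head D a \<notin> verts DW" using head_cases[OF t(2)] a by metis+
  from Cons.IH[OF c _ this] Cons.prems(2)
  show ?case using a h t by (auto simp: pre_digraph.cas.simps pre_digraph.awalk_verts.simps)
qed

lemma walk_to_W:
  assumes "pre_digraph.cas D u p v" "set p \<subseteq> arcs D" "u \<in> verts DW" "v \<in> verts DW" "v \<notin> verts DE"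
  shows "set p \<subseteq> arcs DW \<and> pre_digraph.cas DW u p v \<and>
    pre_digraph.awalk_verts DW u p = pre_digraph.awalk_verts D u p"
  using assms
proof (induction p arbitrary: u)
  case Nil then show ?case by (simp add: pre_digraph.cas.simps pre_digraph.awalk_verts.simps)
next
  case (Cons a p)
  then have t: "tail D a = u" "a \<in> arcs D" and c: "pre_digraph.cas D (head D a) p v"
    by (auto simp: pre_digraph.cas.simps)
  have p: "set p \<subseteq> arcs D" using Cons.prems by auto
  have hW: "head D a \<in> verts DW"
  proof (rule ccontr)
    assume h: "head D a \<notin> verts DW"
    then have "head D a \<in> verts DE" using head_cases[OF t(2)] by metis
    then show False using walk_from_E[OF c p] h Cons.prems by blast
  qed
  then have a: "a \<in> arcs DW" "head D a = head DW a" "a \<notin> arcs DE" using head_cases[OF t(2)] by metis+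
  have "tail DW a = u" using a t juncture_simps by auto
  with Cons.IH[OF c p hW] Cons.prems a t
  show ?case by (auto simp: pre_digraph.cas.simps pre_digraph.awalk_verts.simps)
qed

text \<open>A closed walk returns to the part where it starts and therefore stays inside it, being a
  cycle of that part.\<close>

lemma acyclic_juncture: "\<nexists>p. pre_digraph.cycle D p"
proof
  assume "\<exists>p. pre_digraph.cycle D p"
  then obtain u p where p: "u \<in> verts D" "set p \<subseteq> arcs D" "pre_digraph.cas D u p u"
    "distinct (tl (pre_digraph.awalk_verts D u p))" "p \<noteq> []"
    unfolding pre_digraph.cycle_def pre_digraph.awalk_def by blast
  have no: "\<not> pre_digraph.cycle DW p" "\<not> pre_digraph.cycle DE p"
    using D_graphs unfolding D_graph_def by blast+
  consider "u \<in> verts DW" "u \<notin> verts DE" | "u \<in> verts DE" "u \<notin> verts DW"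
    using p(1) unfolding juncture_simps(1) C_eq by blast
  then show False
  proof cases
    case 1
    with walk_to_W[OF p(3,2)] p no(1) show False
      unfolding pre_digraph.cycle_def pre_digraph.awalk_def by metis
  next
    case 2
    with walk_from_E[OF p(3,2)] p no(2) show False
      unfolding pre_digraph.cycle_def pre_digraph.awalk_def by metis
  qed
qed

lemma D_graph_juncture: "D_graph D"
  unfolding D_graph_def
proof (intro conjI fin_digraph_juncture acyclic_juncture WE_functional_juncture)
  obtain c where "c \<in> C" using C_nonempty by blast
  then have "connected_set (adjacent D) ((verts DW - C) \<union> (verts DE - C))"
    using connected_set_glue[OF connected_verts] C_eq by blast
  then show "weakly_connected D"
    unfolding weakly_connected_iff juncture_simps by (simp add: Un_Diff)
  obtain v where v: "v \<in> inner_verts DW" using D_graphs unfolding D_graph_def by blast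
  then have m: "v \<in> verts DW" "v \<notin> X_verts W DW" "v \<notin> X_verts E DW" unfolding inner_verts_def by auto
  \<comment> \<open>Inner vertices of \<open>DW\<close> survive because the cut consists of
    E-vertices of \<open>DW\<close>.\<close>
  then have "v \<notin> C" using C_E_verts by blast
  then have "v \<notin> verts DE" using m C_eq by blast
  then have "v \<notin> X_verts W DE" "v \<notin> X_verts E DE" by (auto simp: W_verts_iff E_verts_iff)
  then have "v \<in> inner_verts D"
    unfolding inner_verts_def W_verts_juncture E_verts_juncture juncture_simps(1)
    using m \<open>v \<notin> C\<close> by blast
  then show "inner_verts D \<noteq> {}" by blast
qed

end

section \<open>Grounded lists and constructions\<close>

lemma subseq_imp_between:
  assumes "subseq [x, y, z] l" "distinct l"
  shows "between l x y z"
proof -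
  obtain a l1 where 1: "l = a @ x # l1" "subseq [y, z] l1"
    using list_emb_ConsD[OF assms(1)] by auto
  obtain b l2 where 2: "l1 = b @ y # l2" "subseq [z] l2"
    using list_emb_ConsD[OF 1(2)] by auto
  obtain c d where 3: "l2 = c @ z # d"
    using list_emb_ConsD[OF 2(2)] by auto
  have l: "l = a @ x # b @ y # c @ z # d" using 1 2 3 by simp
  have "l ! length a = x" "l ! (length a + Suc (length b)) = y"
    "l ! (length a + Suc (length b) + Suc (length c)) = z"
    unfolding l by (simp_all add: nth_append)
  moreover have "length a + Suc (length b) + Suc (length c) < length l" unfolding l by simp
  ultimately show ?thesis
    unfolding between_def using assms(2) l
    by (intro conjI exI[of _ "length a"] exI[of _ "length a + Suc (length b)"]
        exI[of _ "length a + Suc (length b) + Suc (length c)"]) auto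
qed

text \<open>The sides of a split are connected and disjoint, so they contain semipaths from
  \<open>x\<close> to \<open>z\<close> and from \<open>y\<close> to \<open>t\<close> that do not
  meet, contrary to \<open>psi\<close>.\<close>

lemma grounded_imp_shielded_list:
  assumes g: "grounded X D l" and sp: "split_family (verts D) sp"
    and conn: "\<And>P Q. sp P Q \<Longrightarrow> connected_set (adjacent D) P \<and> connected_set (adjacent D) Q"
  shows "shielded_list sp (X_verts (opp X) D) l"
  unfolding shielded_list_def
proof (intro allI impI shieldedI)
  fix x y z P Q t
  assume s: "subseq [x, y, z] l" and pq: "sp P Q" and m: "x \<in> P" "z \<in> P" "y \<in> Q" "t \<in> Q"
    and t: "t \<in> X_verts (opp X) D"
  have psi: "psi X D x y z"
    using g subseq_imp_between[OF s] unfolding grounded_def list_of_def by blast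
  have V: "P \<subseteq> verts D" "Q \<subseteq> verts D" and disj: "P \<inter> Q = {}"
    using split_family.sp_cover[OF sp pq] split_family.sp_disjoint[OF sp pq] by auto
  obtain p where p: "p \<in> semipaths D x z" "set (fst p) \<subseteq> P"
    using connected_set_semipath[of D P x z] conn[OF pq] V m by blast
  obtain q where q: "q \<in> semipaths D y t" "set (fst q) \<subseteq> Q"
    using connected_set_semipath[of D Q y t] conn[OF pq] V m by blast
  have "q \<in> semipaths_to (opp X) D y" using q(1) t unfolding semipaths_to_def by blast
  then have "intersect p q" using psi p(1) unfolding psi_def by blast
  then show False using p(2) q(2) disj unfolding intersect_def by blast
qed

section \<open>The invariant of the induction and its preservation\<close>

definition constructible :: "('v, 'e) pre_digraph \<Rightarrow> 'v list \<Rightarrow> 'v list \<Rightarrow> bool" where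
  "constructible D LW LE \<longleftrightarrow> (\<exists>K. construction K \<and> root_label K = (D, LW, LE))"

definition realizing :: "('v, 'e) pre_digraph \<Rightarrow> ('v set \<Rightarrow> 'v set \<Rightarrow> bool) \<Rightarrow> bool" where
  "realizing D sp \<longleftrightarrow>
     (\<forall>LW LE. list_of LW (X_verts W D) \<longrightarrow> list_of LE (X_verts E D) \<longrightarrow> planar sp LW LE \<longrightarrow>
        constructible D LW LE)"

text \<open>The existence clause makes \<open>realizing\<close> yield a construction in the end. At
  a juncture it also supplies shielded lists of the W-vertices of \<open>DW\<close> and the
  E-vertices of \<open>DE\<close>, on which P-compatibility is silent.\<close>

definition good_family :: "('v, 'e) pre_digraph \<Rightarrow> ('v set \<Rightarrow> 'v set \<Rightarrow> bool) \<Rightarrow> bool" where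
  "good_family D sp \<longleftrightarrow>
     board (verts D) sp (X_verts W D) (X_verts E D) \<and>
     (\<forall>P Q. sp P Q \<longrightarrow> connected_set (adjacent D) P \<and> connected_set (adjacent D) Q) \<and>
     orientable sp (X_verts W D) (X_verts E D) \<and> realizing D sp \<and>
     (\<exists>LW LE. list_of LW (X_verts W D) \<and> list_of LE (X_verts E D) \<and> planar sp LW LE)"

lemma constructible_basic:
  assumes "basic_D_graph D" "list_of LW (X_verts W D)" "list_of LE (X_verts E D)"
  shows "constructible D LW LE"
proof -
  have "construction (Single (D, LW, LE))"
    using assms unfolding basic_D_graph_def
    by (intro construction.single) (auto simp: basic_D_graph_def valid_label_def)
  then show ?thesis unfolding constructible_def by force
qed

text \<open>A single node admits arbitrary lists, so no split may impose a condition.\<close>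

lemma good_family_basic:
  assumes "basic_D_graph D"
  shows "good_family D (\<lambda>_ _. False)"
proof -
  have D: "D_graph D" using assms unfolding basic_D_graph_def by blast
  then have fin: "finite (verts D)" unfolding D_graph_def
    by (simp add: fin_digraph.finite_verts)
  have triv: "planar (\<lambda>_ _. False) LW LE" for LW LE :: "'a list"
    unfolding planar_def shielded_list_def shielded_def uncrossed_def by simp
  have sub: "X_verts X D \<subseteq> verts D" for X by (rule subsetI) (rule X_verts_in_verts)
  have "board (verts D) (\<lambda>_ _. False) (X_verts W D) (X_verts E D)"
    using sub X_verts_disjoint[OF D] basic_X_verts_nonempty[OF assms] by unfold_locales auto
  moreover have "\<exists>L. list_of L (X_verts X D)" for X
    unfolding list_of_def using finite_distinct_list[OF finite_subset[OF sub fin]] by metis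
  ultimately show ?thesis
    unfolding good_family_def realizing_def orientable_def
    using triv constructible_basic[OF assms] by metis
qed

context defined_juncture
begin

lemma glued_verts:
  assumes "board (verts DW) sp1 (X_verts W DW) (X_verts E DW)"
    and "board (verts DE) sp2 (X_verts W DE) (X_verts E DE)"
  shows "glued (verts DW) sp1 (X_verts W DW) (X_verts E DW) (verts DE) sp2 (X_verts W DE) (X_verts E DE) C"
  using assms C_eq C_nonempty C_E_verts C_W_verts
  by (intro glued.intro glued_axioms.intro) auto

lemma connected_glue_sp:
  assumes "glue_sp (verts DW) sp1 (verts DE) sp2 C P Q"
    and c1: "\<And>P Q. sp1 P Q \<Longrightarrow> connected_set (adjacent DW) P \<and> connected_set (adjacent DW) Q"
    and c2: "\<And>P Q. sp2 P Q \<Longrightarrow> connected_set (adjacent DE) P \<and> connected_set (adjacent DE) Q"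
  shows "connected_set (adjacent D) P \<and> connected_set (adjacent D) Q"
  using assms(1)
proof induction
  case base
  show ?case using connected_set_diff_W connected_set_diff_E connected_verts by blast
next
  case (ext1 P Q c)
  then show ?case
    using connected_set_glue[of P "verts DE" c] connected_set_diff_W[of Q] c1[of P Q] connected_verts C_eq
    by blast
next
  case (ext2 P Q c)
  then show ?case
    using connected_set_glue[of "verts DW" P c] connected_set_diff_E[of Q] c2[of P Q] connected_verts C_eq
    by (metis IntE Un_commute)
next
  case (both P Q R T c d)
  then show ?case
    using connected_set_glue[of P R c] connected_set_glue[of Q T d] c1[of P Q] c2[of R T] by blast
next
  case (sym P Q) then show ?case by blast
qed

lemma constructible_juncture:
  assumes KW: "constructible DW LWW (FE @ X @ PE)" and KE: "constructible DE (FW @ X @ PW) LEE"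
    and parts: "compatible_parts FE FW X PE PW"
    and LW: "list_of (FW @ LWW @ PW) (X_verts W D)" and LE: "list_of (FE @ LEE @ PE) (X_verts E D)"
  shows "constructible D (FW @ LWW @ PW) (FE @ LEE @ PE)"
proof -
  obtain TW TE where T: "construction TW" "root_label TW = (DW, LWW, FE @ X @ PE)"
    "construction TE" "root_label TE = (DE, FW @ X @ PW, LEE)"
    using KW KE unfolding constructible_def by blast
  let ?l = "(D, FW @ LWW @ PW, FE @ LEE @ PE)"
  have "valid_label ?l" unfolding valid_label_def using D_graph_juncture LW LE by simp
  then have "construction (Branch ?l TW TE)"
    by (rule construction.branch[OF T defined parts refl])
  then show ?thesis unfolding constructible_def by force
qed

lemma good_family_juncture:
  assumes W: "good_family DW sp1" and E: "good_family DE sp2"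
    and \<Gamma>: "grounded side.E DW (F1 @ X @ P1)" and \<Delta>: "grounded side.W DE (F2 @ X @ P2)"
    and cp: "compatible_parts F1 F2 X P1 P2"
  shows "good_family D (glue_sp (verts DW) sp1 (verts DE) sp2 C)"
proof -
  have bW: "board (verts DW) sp1 (X_verts side.W DW) (X_verts side.E DW)"
    and bE: "board (verts DE) sp2 (X_verts side.W DE) (X_verts side.E DE)"
    and c1: "\<And>P Q. sp1 P Q \<Longrightarrow> connected_set (adjacent DW) P \<and> connected_set (adjacent DW) Q"
    and c2: "\<And>P Q. sp2 P Q \<Longrightarrow> connected_set (adjacent DE) P \<and> connected_set (adjacent DE) Q"
    and o: "orientable sp1 (X_verts side.W DW) (X_verts side.E DW)"
      "orientable sp2 (X_verts side.W DE) (X_verts side.E DE)"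
    and r: "realizing DW sp1" "realizing DE sp2"
    using W E unfolding good_family_def by blast+
  have s1: "shielded_list sp1 (X_verts side.W DW) (F1 @ X @ P1)"
    using grounded_imp_shielded_list[OF \<Gamma> board.axioms(1)[OF bW] c1] by simp
  have s2: "shielded_list sp2 (X_verts side.E DE) (F2 @ X @ P2)"
    using grounded_imp_shielded_list[OF \<Delta> board.axioms(1)[OF bE] c2] by simp
  interpret G: compatible_glued "verts DW" sp1 "X_verts side.W DW" "X_verts side.E DW"
    "verts DE" sp2 "X_verts side.W DE" "X_verts side.E DE" C F1 F2 X P1 P2
    using glued_verts[OF bW bE] \<Gamma> \<Delta> cp o s1 s2
    by (intro compatible_glued.intro compatible_glued_axioms.intro)
      (auto simp: compatible_parts_def grounded_def)
  have realize: "constructible D LW LE"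
    if LW: "list_of LW (X_verts side.W D)" and LE: "list_of LE (X_verts side.E D)"
      and p: "planar G.sp LW LE" for LW LE
  proof -
    note LW' = LW[unfolded W_verts_juncture] and LE' = LE[unfolded E_verts_juncture]
    from G.parts_if_planar[OF LW' LE' p] LW' LE' show ?thesis
    proof (rule G.partsE)
      fix FA L1 PA FB L2 PB Y
      assume *: "LW = FA @ L1 @ PA" "LE = FB @ L2 @ PB"
        "FA = [] \<or> FB = []" "PA = [] \<or> PB = []" "set Y = C" "distinct Y"
        "set L1 = X_verts side.W DW" "set L2 = X_verts side.E DE"
        "set FA \<union> set PA = X_verts side.W DE - C" "set FB \<union> set PB = X_verts side.E DW - C"
        "planar sp1 L1 (FB @ Y @ PB)" "planar sp2 (FA @ Y @ PA) L2"
      have d: "distinct LW" "distinct LE" using LW LE unfolding list_of_def by auto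
      have lists: "list_of L1 (X_verts side.W DW)" "list_of (FB @ Y @ PB) (X_verts side.E DW)"
        "list_of (FA @ Y @ PA) (X_verts side.W DE)" "list_of L2 (X_verts side.E DE)"
        using d * C_E_verts C_W_verts unfolding list_of_def by auto
      \<comment> \<open>This separates the overhanging letters of \<open>LW\<close> from those of
        \<open>LE\<close>, as compatibility demands.\<close>
      have "(X_verts side.W DE - C) \<inter> (X_verts side.E DW - C) = {}"
        using C_eq by (auto dest: X_verts_in_verts)
      then have "compatible_parts FB FA Y PB PA"
        unfolding compatible_parts_def using d * C_nonempty by auto
      then show ?thesis
        using constructible_juncture[of L1 FB Y PB FA PA L2] r lists * LW LE
        unfolding realizing_def by blast
    qed
  qed
  have "\<exists>LW LE. list_of LW (X_verts side.W D) \<and> list_of LE (X_verts side.E D) \<and> planar G.sp LW LE"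
  proof -
    obtain LW LE LW' LE' where
      "list_of LW (X_verts side.W DW)" "planar sp1 LW LE'" "list_of LE' (X_verts side.E DW)"
      "list_of LE (X_verts side.E DE)" "planar sp2 LW' LE" "list_of LW' (X_verts side.W DE)"
      using W E unfolding good_family_def by blast
    then have "list_of LW (X_verts side.W DW)" "shielded_list sp1 (X_verts side.E DW) LW"
      "list_of LE (X_verts side.E DE)" "shielded_list sp2 (X_verts side.W DE) LE"
      unfolding planar_def list_of_def by auto
    from G.planar_glue_exists[OF this] show ?thesis
      unfolding W_verts_juncture E_verts_juncture by blast
  qed
  moreover have "board (verts D) G.sp (X_verts side.W D) (X_verts side.E D)"
    using G.board_axioms unfolding W_verts_juncture E_verts_juncture juncture_simps .
  moreover have "orientable G.sp (X_verts side.W D) (X_verts side.E D)"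
    using G.orientable_glue unfolding W_verts_juncture E_verts_juncture .
  ultimately show ?thesis
    unfolding good_family_def realizing_def using realize connected_glue_sp[OF _ c1 c2] by blast
qed

end

lemma P''_graph_good_family: "P''_graph D \<Longrightarrow> \<exists>sp. good_family D sp"
proof (induction rule: P''_graph.induct)
  case (basic D)
  then show ?case using good_family_basic by blast
next
  case (junct DW DE)
  then obtain F1 F2 X P1 P2 where *: "juncture_defined DW DE"
    "grounded E DW (F1 @ X @ P1)" "grounded W DE (F2 @ X @ P2)" "compatible_parts F1 F2 X P1 P2"
    unfolding P_compatible_def compatible_def by blast
  interpret defined_juncture DW DE using *(1) by unfold_locales
  show ?case using junct.IH good_family_juncture *(2-4) by blast
qed

theorem theorem4p4p5:
  fixes D :: "('v, 'e) pre_digraph"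
  assumes "P''_graph D"
  shows "P'_graph D"
proof -
  obtain sp where "good_family D sp" using P''_graph_good_family[OF assms] by blast
  then obtain LW LE where "constructible D LW LE"
    unfolding good_family_def realizing_def by blast
  then show ?thesis unfolding P'_graph_def constructible_def root_graph_def by force
qed

end
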